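(* Let $n\ge 2$ and let $K\subseteq\mathbb{R}^n$ be a convex body. There exists a set $A\subseteq K$ such that $\mathrm{Vol}(A)/\mathrm{Vol}(K)=1/2$ and $$\mathbb{P}\left(\frac{\mathrm{length}(L\cap A)}{\mathrm{length}(L\cap K)}\in\{0,1\}\right)=1-O^*\left(\frac{1}{\sqrt{n}}\right),$$ where $L=X+\mathbb{R}\theta$, and $X$ and $\theta$ are independent random vectors distributed uniformly in $K$ and on $S^{n-1}$ respectively.
   Context: A convex body is a compact convex set with nonempty interior. $S^{n-1}$ is the unit sphere in $\mathbb{R}^n$, and $\mathrm{length}$ denotes one-dimensional Lebesgue measure on the line $L$. $O^*$ denotes big-$O$ up to logarithmic factors: the statement means that there are universal constants $C,\alpha>0$ (independent of $n$ and $K$) such that the probability is at least $1-C(\log n)^{\alpha}/\sqrt{n}$. *)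

theory Defs
  imports "HOL-Analysis.Analysis"
begin

text \<open>The dimension is quantified inside the statement (the constants must not depend on it), so
  Euclidean \<open>n\<close>-space is \<open>{..<n} \<rightarrow>\<^sub>E UNIV\<close>: real functions on \<open>{..<n}\<close>, \<^const>\<open>undefined\<close> elsewhere.
  This is both the topspace of \<open>powertop_real {..<n}\<close> and the space of the product measure below.\<close>

abbreviation vol :: "nat \<Rightarrow> (nat \<Rightarrow> real) measure" where
  "vol n \<equiv> PiM {..<n} (\<lambda>_. lborel)"

definition convex_body :: "nat \<Rightarrow> (nat \<Rightarrow> real) set \<Rightarrow> bool" where
  "convex_body n K \<longleftrightarrow>
     compactin (powertop_real {..<n}) K \<and>
     (\<forall>x\<in>K. \<forall>y\<in>K. \<forall>u\<ge>0. \<forall>v\<ge>0. u + v = 1 \<longrightarrow> (\<lambda>i\<in>{..<n}. u * x i + v * y i) \<in> K) \<and>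
     powertop_real {..<n} interior_of K \<noteq> {}"

definition unit_ball :: "nat \<Rightarrow> (nat \<Rightarrow> real) set" where
  "unit_ball n = {x \<in> {..<n} \<rightarrow>\<^sub>E UNIV. L2_set x {..<n} \<le> 1}"

text \<open>The uniform distribution on the unit sphere as the normalized cone measure: the law of
  \<open>y / |y|\<close> for \<open>y\<close> uniform in the unit ball. It is the normalized surface measure, i.e. the unique
  rotation invariant probability measure on the sphere. The null event \<open>y = 0\<close> is sent to \<open>0\<close>.\<close>

definition uniform_sphere :: "nat \<Rightarrow> (nat \<Rightarrow> real) measure" where
  "uniform_sphere n =
     distr (uniform_measure (vol n) (unit_ball n)) (vol n)
       (\<lambda>y. \<lambda>i\<in>{..<n}. y i / L2_set y {..<n})"

definition line_point :: "nat \<Rightarrow> (nat \<Rightarrow> real) \<Rightarrow> (nat \<Rightarrow> real) \<Rightarrow> real \<Rightarrow> (nat \<Rightarrow> real)" where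
  "line_point n x \<theta> t = (\<lambda>i\<in>{..<n}. x i + t * \<theta> i)"

definition line :: "nat \<Rightarrow> (nat \<Rightarrow> real) \<Rightarrow> (nat \<Rightarrow> real) \<Rightarrow> (nat \<Rightarrow> real) set" where
  "line n x \<theta> = range (line_point n x \<theta>)"

text \<open>One-dimensional Lebesgue measure on the line through \<open>x\<close> with direction \<open>\<theta>\<close>;
  \<open>t \<mapsto> x + t \<theta>\<close> is an isometric parametrization because it is only used for unit vectors \<open>\<theta>\<close>.\<close>

definition line_length :: "nat \<Rightarrow> (nat \<Rightarrow> real) \<Rightarrow> (nat \<Rightarrow> real) \<Rightarrow> (nat \<Rightarrow> real) set \<Rightarrow> real" where
  "line_length n x \<theta> S = measure lborel {t. line_point n x \<theta> t \<in> S}"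

text \<open>The joint law of the independent pair \<open>(X, \<theta>)\<close>.\<close>

definition random_line :: "nat \<Rightarrow> (nat \<Rightarrow> real) set \<Rightarrow> ((nat \<Rightarrow> real) \<times> (nat \<Rightarrow> real)) measure" where
  "random_line n K = uniform_measure (vol n) K \<Otimes>\<^sub>M uniform_sphere n"

end

theory Submission
  imports Defs "HOL-Probability.Weak_Convergence"
begin

text \<open>The set \<open>A\<close> is a slab. Let \<open>\<sigma>\<^sup>2\<close> be the largest of the variances of the coordinates of \<open>X\<close>, attained at the
coordinate \<open>i\<close>, and let \<open>A = {x \<in> K. a < x\<^sub>i \<le> b}\<close>, where \<open>a\<close> and \<open>b\<close> are the quantiles of \<open>X\<^sub>i\<close> at
\<open>q\<close> and \<open>q + 1/2\<close>. For every \<open>q\<close> in \<open>(0, 1/2)\<close> the slab has half the volume of \<open>K\<close>, and a chord of \<open>K\<close>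
that meets neither of the hyperplanes \<open>x\<^sub>i = a\<close> and \<open>x\<^sub>i = b\<close> lies in \<open>A\<close> or misses \<open>A\<close>. When \<open>q\<close> is
uniform in \<open>(0, 1/2)\<close>, the two levels \<open>a\<close> and \<open>b\<close> together sweep out the law of \<open>X\<^sub>i\<close>. Hence, for a suitable
\<open>q\<close>, the probability that the random chord crosses one of them is at most a constant times the
probability that it crosses an independent random level with the law of \<open>X\<^sub>i\<close> (\<open>halving_quantiles\<close>).

The levels that a chord of length \<open>l\<close> with direction \<open>\<theta>\<close> crosses form an interval of length \<open>l |\<theta>\<^sub>i|\<close>. The
law of \<open>X\<^sub>i\<close> is log-concave by the Prekopa-Leindler inequality, so its mass on an interval of
length \<open>w\<close> is at most a constant times \<open>w / \<sigma>\<close> (\<open>midpoint_log_concave_interval_bound\<close>). What remains is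
to bound the mean of \<open>l |\<theta>\<^sub>i|\<close> by a constant times \<open>\<sigma> / sqrt n\<close>. By symmetry of the sphere, the mean
of \<open>\<theta>\<^sub>i\<^sup>2\<close> is at most \<open>1 / n\<close>. For the length, fix \<open>\<theta>\<close>. Given the chord through \<open>X\<close>, the point \<open>X\<close> is uniform on that
chord, so the linear form \<open>\<theta> \<bullet> X\<close> is uniform on an interval of length \<open>l\<close>. Therefore the mean
of \<open>l\<^sup>2\<close> over \<open>X\<close> is at most a constant times the variance of \<open>\<theta> \<bullet> X\<close> (\<open>chord_second_moment\<close>). Averaged
over \<open>\<theta>\<close>, this variance is the trace of the covariance matrix divided by \<open>n\<close>
(\<open>uniform_sphere_linear_sq\<close>), which is at most \<open>\<sigma>\<^sup>2\<close> by the choice of \<open>i\<close>.\<close>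

section \<open>The Prekopa-Leindler inequality at midpoints\<close>

text \<open>The translates \<open>A \<inter> {..a} + b\<close> and \<open>a + B \<inter> {b..}\<close> both lie in \<open>A + B\<close> and meet at most in \<open>a + b\<close>, so
the measure of \<open>A + B\<close> is at least the sum of theirs. The set \<open>C\<close> contains the halved sum.\<close>

lemma brunn_minkowski_halflines:
  fixes A B C :: "real set"
  assumes [measurable]: "A \<in> sets borel" "B \<in> sets borel" "C \<in> sets borel"
    and "a \<in> A" "b \<in> B"
    and mid: "\<And>x y. x \<in> A \<Longrightarrow> y \<in> B \<Longrightarrow> (x + y) / 2 \<in> C"
  shows "emeasure lborel (A \<inter> {..a}) + emeasure lborel (B \<inter> {b..}) \<le> 2 * emeasure lborel C"
proof -
  have "emeasure lborel (A \<inter> {..a}) = (\<integral>\<^sup>+x. indicator (A \<inter> {..a}) (x - b) \<partial>lborel)"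
    using nn_integral_real_affine[of "indicator (A \<inter> {..a})" 1 "-b"] by simp
  moreover have "emeasure lborel (B \<inter> {b..}) = (\<integral>\<^sup>+x. indicator (B \<inter> {b..}) (x - a) \<partial>lborel)"
    using nn_integral_real_affine[of "indicator (B \<inter> {b..})" 1 "-a"] by simp
  ultimately have "emeasure lborel (A \<inter> {..a}) + emeasure lborel (B \<inter> {b..})
     = (\<integral>\<^sup>+x. indicator (A \<inter> {..a}) (x - b) + indicator (B \<inter> {b..}) (x - a) \<partial>lborel)"
    by (subst nn_integral_add) auto
  also have "\<dots> \<le> (\<integral>\<^sup>+x. indicator C (x / 2) \<partial>lborel)"
  proof (rule nn_integral_mono_AE)
    have "AE x in lborel. x \<noteq> a + b" by (rule AE_lborel_singleton)
    then show "AE x in lborel. indicator (A \<inter> {..a}) (x - b) + indicator (B \<inter> {b..}) (x - a)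
        \<le> (indicator C (x / 2) :: ennreal)"
    proof eventually_elim
      case (elim x)
      show ?case
        using elim mid[of "x - b" b] mid[of a "x - a"] \<open>a \<in> A\<close> \<open>b \<in> B\<close>
        by (auto simp: indicator_def)
    qed
  qed
  also have "\<dots> = 2 * emeasure lborel C"
    using nn_integral_real_affine[of "\<lambda>x. indicator C (x/2)" 2 0] by simp
  finally show ?thesis .
qed

text \<open>The half-line version applied to points \<open>a\<close> close to the supremum of \<open>A\<close> and \<open>b\<close> close to the infimum
of \<open>B\<close>; the parts cut off have measure at most \<open>e / 2\<close> each.\<close>

lemma brunn_minkowski_real:
  fixes A B C :: "real set"
  assumes [measurable]: "A \<in> sets borel" "B \<in> sets borel" "C \<in> sets borel"
    and ne: "A \<noteq> {}" "B \<noteq> {}" and bdd: "bdd_above A" "bdd_below B"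
    and mid: "\<And>x y. x \<in> A \<Longrightarrow> y \<in> B \<Longrightarrow> (x + y) / 2 \<in> C"
  shows "emeasure lborel A + emeasure lborel B \<le> 2 * emeasure lborel C"
proof (rule ennreal_le_epsilon)
  fix e :: real assume "e > 0"
  obtain a where a: "a \<in> A" "Sup A - e / 2 < a"
    using less_cSup_iff[OF ne(1) bdd(1), of "Sup A - e/2"] \<open>e > 0\<close> by auto
  obtain b where b: "b \<in> B" "b < Inf B + e / 2"
    using cInf_less_iff[OF ne(2) bdd(2), of "Inf B + e/2"] \<open>e > 0\<close> by auto
  have le: "a \<le> Sup A" "Inf B \<le> b"
    using a b bdd by (auto intro: cSup_upper cInf_lower)
  have "emeasure lborel A \<le> emeasure lborel ((A \<inter> {..a}) \<union> {a..Sup A})"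
    using bdd by (intro emeasure_mono) (auto intro: cSup_upper)
  also have "\<dots> \<le> emeasure lborel (A \<inter> {..a}) + emeasure lborel {a..Sup A}"
    by (intro emeasure_subadditive) auto
  also have "\<dots> \<le> emeasure lborel (A \<inter> {..a}) + ennreal (e / 2)"
    using a le by (intro add_left_mono) (auto simp: intro!: ennreal_leI)
  finally have 1: "emeasure lborel A \<le> emeasure lborel (A \<inter> {..a}) + ennreal (e / 2)" .
  have "emeasure lborel B \<le> emeasure lborel ((B \<inter> {b..}) \<union> {Inf B..b})"
    using bdd by (intro emeasure_mono) (auto intro: cInf_lower)
  also have "\<dots> \<le> emeasure lborel (B \<inter> {b..}) + emeasure lborel {Inf B..b}"
    by (intro emeasure_subadditive) auto
  also have "\<dots> \<le> emeasure lborel (B \<inter> {b..}) + ennreal (e / 2)"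
    using b le by (intro add_left_mono) (auto simp: intro!: ennreal_leI)
  finally have 2: "emeasure lborel B \<le> emeasure lborel (B \<inter> {b..}) + ennreal (e / 2)" .
  have "emeasure lborel A + emeasure lborel B \<le>
     (emeasure lborel (A \<inter> {..a}) + emeasure lborel (B \<inter> {b..})) + (ennreal (e / 2) + ennreal (e / 2))"
    using add_mono[OF 1 2] by (simp add: ac_simps)
  also have "ennreal (e / 2) + ennreal (e / 2) = ennreal e"
    using \<open>e > 0\<close> by (simp flip: ennreal_plus)
  also have "emeasure lborel (A \<inter> {..a}) + emeasure lborel (B \<inter> {b..}) \<le> 2 * emeasure lborel C"
    by (rule brunn_minkowski_halflines) (use a b mid in auto)
  finally show "emeasure lborel A + emeasure lborel B \<le> 2 * emeasure lborel C + ennreal e"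
    by (simp add: add_right_mono)
qed

lemma layer_cake:
  assumes "sigma_finite_measure M" and [measurable]: "f \<in> borel_measurable M"
  shows "(\<integral>\<^sup>+x. f x \<partial>M) =
    (\<integral>\<^sup>+t. indicator {0<..} t * emeasure M {x \<in> space M. ennreal t < f x} \<partial>lborel)"
proof -
  interpret sigma_finite_measure M by fact
  interpret pair_sigma_finite M lborel by standard
  have eq: "f x = (\<integral>\<^sup>+t. indicator {t. 0 < t \<and> ennreal t < f x} t \<partial>lborel)" for x
  proof (cases "f x")
    case (real r)
    then have "{t. 0 < t \<and> ennreal t < f x} = {0<..<r}"
      by (auto simp: ennreal_less_iff)
    then show ?thesis using real by simp
  next
    case top
    have "of_nat n \<le> emeasure lborel {0::real<..}" for n
    proof -
      have "emeasure lborel {0<..<real n} \<le> emeasure lborel {0::real<..}"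
        by (rule emeasure_mono) auto
      then show ?thesis by (simp add: ennreal_of_nat_eq_real_of_nat)
    qed
    then have "emeasure lborel {0::real<..} = \<infinity>"
      by (metis ennreal_Ex_less_of_nat infinity_ennreal_def less_top not_le)
    moreover have "{t. 0 < t \<and> ennreal t < f x} = {0<..}" using top by auto
    ultimately show ?thesis using top by simp
  qed
  have "(\<integral>\<^sup>+x. f x \<partial>M) = (\<integral>\<^sup>+x. (\<integral>\<^sup>+t. indicator {0<..} t * indicator {x \<in> space M. ennreal t < f x} x \<partial>lborel) \<partial>M)"
  proof (rule nn_integral_cong)
    fix x assume "x \<in> space M"
    then show "f x = (\<integral>\<^sup>+t. indicator {0<..} t * indicator {x \<in> space M. ennreal t < f x} x \<partial>lborel)"
      by (subst eq) (intro nn_integral_cong, auto simp: indicator_def)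
  qed
  also have "\<dots> = (\<integral>\<^sup>+t. (\<integral>\<^sup>+x. indicator {0<..} t * indicator {x \<in> space M. ennreal t < f x} x \<partial>M) \<partial>lborel)"
    by (subst Fubini'[where f = "\<lambda>x t. indicator {0<..} t * indicator {x \<in> space M. ennreal t < f x} x"]) auto
  also have "\<dots> = (\<integral>\<^sup>+t. indicator {0<..} t * emeasure M {x \<in> space M. ennreal t < f x} \<partial>lborel)"
    by (intro nn_integral_cong) (simp add: nn_integral_cmult)
  finally show ?thesis .
qed

lemma ennreal_am_gm:
  fixes p q r :: ennreal
  assumes "p + q \<le> 2 * r"
  shows "p * q \<le> r ^ 2"
proof (cases "r = \<infinity>")
  case True then show ?thesis by simp
next
  case False
  then have "p + q \<noteq> \<infinity>" using assms by (auto simp: ennreal_mult_eq_top_iff top_unique)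
  then obtain p' q' r' where e: "p = ennreal p'" "q = ennreal q'" "r = ennreal r'" "p' \<ge> 0" "q' \<ge> 0" "r' \<ge> 0"
    using False by (cases p; cases q; cases r) auto
  have "2 * ennreal r' = ennreal (2 * r')" using e by (simp add: ennreal_mult)
  then have "p' + q' \<le> 2 * r'" using assms e by (simp flip: ennreal_plus)
  moreover have "0 \<le> (p' - q')\<^sup>2" by simp
  ultimately have "p' * q' \<le> r'\<^sup>2"
    using e power_mono[of "p' + q'" "2 * r'" 2] by (simp add: power2_eq_square algebra_simps)
  then show ?thesis using e by (simp add: ennreal_power flip: ennreal_mult)
qed

text \<open>When both suprema equal 1, the superlevel sets of \<open>f\<close> and \<open>g\<close> at a height \<open>t < 1\<close> are nonempty and
their midpoints lie in the superlevel set of \<open>h\<close>, because \<open>t * t < f x * g y\<close>. The one-dimensional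
Brunn-Minkowski inequality applies at each height and the layer cake formula integrates it.\<close>

lemma prekopa_leindler_normalized:
  fixes f g h :: "real \<Rightarrow> ennreal"
  assumes [measurable]: "f \<in> borel_measurable borel" "g \<in> borel_measurable borel" "h \<in> borel_measurable borel"
    and sup: "(SUP x. f x) = 1" "(SUP x. g x) = 1"
    and supp: "\<And>x. f x \<noteq> 0 \<Longrightarrow> \<bar>x\<bar> \<le> N" "\<And>x. g x \<noteq> 0 \<Longrightarrow> \<bar>x\<bar> \<le> N"
    and mid: "\<And>x y. f x * g y \<le> (h ((x + y) / 2)) ^ 2"
  shows "(\<integral>\<^sup>+x. f x \<partial>lborel) + (\<integral>\<^sup>+x. g x \<partial>lborel) \<le> 2 * (\<integral>\<^sup>+x. h x \<partial>lborel)"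
proof -
  have le: "emeasure lborel {x. ennreal t < f x} + emeasure lborel {x. ennreal t < g x}
      \<le> 2 * emeasure lborel {x. ennreal t < h x}" if "t > 0" for t
  proof (cases "t < 1")
    case False
    have "f x \<le> 1" "g x \<le> 1" for x using sup by (metis SUP_upper UNIV_I)+
    moreover have "1 \<le> ennreal t" using False by simp
    ultimately have "f x \<le> ennreal t" "g x \<le> ennreal t" for x by (meson order_trans)+
    then have "{x. ennreal t < f x} = {}" "{x. ennreal t < g x} = {}"
      by (auto simp: not_less)
    then show ?thesis by simp
  next
    case True
    then have t1: "ennreal t < 1" by (simp add: ennreal_less_one_iff)
    show ?thesis
    proof (rule brunn_minkowski_real)
      show "{x. ennreal t < f x} \<noteq> {}" "{x. ennreal t < g x} \<noteq> {}"
        using t1 less_SUP_iff[of "ennreal t" f UNIV] less_SUP_iff[of "ennreal t" g UNIV] unfolding sup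
        by auto
      show "bdd_above {x. ennreal t < f x}" "bdd_below {x. ennreal t < g x}"
        using supp by (auto intro!: bdd_aboveI[of _ N] bdd_belowI[of _ "-N"] simp: abs_le_iff)
           (smt (verit) not_less_zero)+
      fix x y assume "x \<in> {x. ennreal t < f x}" "y \<in> {x. ennreal t < g x}"
      then have t: "ennreal t < f x" "ennreal t < g y" by auto
      have "ennreal t * ennreal t < ennreal t * g y"
        using t \<open>t > 0\<close> by (intro ennreal_mult_strict_left_mono) auto
      also have "\<dots> \<le> f x * g y"
        using t by (intro mult_right_mono) auto
      also have "\<dots> \<le> (h ((x + y) / 2)) ^ 2" by (rule mid)
      finally have "ennreal t < h ((x + y) / 2)"
        using mult_mono[of "h ((x + y) / 2)" "ennreal t" "h ((x + y) / 2)" "ennreal t"]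
        by (auto simp: power2_eq_square not_less[symmetric])
      then show "(x + y) / 2 \<in> {x. ennreal t < h x}" by simp
    qed measurable
  qed
  have "(\<integral>\<^sup>+x. f x \<partial>lborel) + (\<integral>\<^sup>+x. g x \<partial>lborel) = 
     (\<integral>\<^sup>+t. indicator {0<..} t * (emeasure lborel {x. ennreal t < f x} + emeasure lborel {x. ennreal t < g x}) \<partial>lborel)"
    by (subst (1 2) layer_cake) (auto simp: sigma_finite_lborel distrib_left nn_integral_add)
  also have "\<dots> \<le> (\<integral>\<^sup>+t. 2 * (indicator {0<..} t * emeasure lborel {x. ennreal t < h x}) \<partial>lborel)"
    using le by (intro nn_integral_mono) (auto simp: indicator_def)
  also have "\<dots> = 2 * (\<integral>\<^sup>+x. h x \<partial>lborel)"
    by (subst layer_cake) (auto simp: sigma_finite_lborel nn_integral_cmult)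
  finally show ?thesis .
qed

text \<open>Dividing \<open>f\<close> and \<open>g\<close> by their suprema \<open>F\<close> and \<open>G\<close>, and \<open>h\<close> by \<open>sqrt (F * G)\<close>, reduces to the
normalized case. There the inequality is additive; the arithmetic-geometric mean inequality makes
it multiplicative, and in this form the scaling factors cancel.\<close>

lemma prekopa_leindler_bounded:
  fixes f g h :: "real \<Rightarrow> ennreal"
  assumes [measurable]: "f \<in> borel_measurable borel" "g \<in> borel_measurable borel" "h \<in> borel_measurable borel"
    and bdd: "\<And>x. f x \<le> ennreal B" "\<And>x. g x \<le> ennreal B"
    and supp: "\<And>x. f x \<noteq> 0 \<Longrightarrow> \<bar>x\<bar> \<le> N" "\<And>x. g x \<noteq> 0 \<Longrightarrow> \<bar>x\<bar> \<le> N"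
    and mid: "\<And>x y. f x * g y \<le> (h ((x + y) / 2)) ^ 2"
  shows "(\<integral>\<^sup>+x. f x \<partial>lborel) * (\<integral>\<^sup>+x. g x \<partial>lborel) \<le> (\<integral>\<^sup>+x. h x \<partial>lborel) ^ 2"
proof -
  define F where "F = (SUP x. f x)"
  define G where "G = (SUP x. g x)"
  have fF: "f x \<le> F" and gG: "g x \<le> G" for x unfolding F_def G_def by (auto intro: SUP_upper)
  have "F \<le> ennreal B" "G \<le> ennreal B" unfolding F_def G_def using bdd by (auto intro: SUP_least)
  then have fin: "F < top" "G < top" by (auto intro: le_less_trans)
  show ?thesis
  proof (cases "F = 0 \<or> G = 0")
    case True
    then have "(\<forall>x. f x = 0) \<or> (\<forall>x. g x = 0)" using fF gG by (metis le_zero_eq)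
    then show ?thesis by auto
  next
    case False
    define a where "a = enn2real F"
    define b where "b = enn2real G"
    have ab: "F = ennreal a" "G = ennreal b" using fin by (auto simp: a_def b_def)
    have pos: "a > 0" "b > 0"
      using False fin unfolding a_def b_def enn2real_positive_iff by (auto simp: zero_less_iff_neq_zero)
    define c where "c = ennreal (sqrt (a * b))"
    have c: "c ^ 2 = F * G" "c \<noteq> 0" "c < top"
      using pos by (auto simp: c_def ab ennreal_power ennreal_mult[symmetric])
    have *: "(\<integral>\<^sup>+x. f x / F \<partial>lborel) + (\<integral>\<^sup>+x. g x / G \<partial>lborel) \<le> 2 * (\<integral>\<^sup>+x. h x / c \<partial>lborel)"
    proof (rule prekopa_leindler_normalized)
      show "(SUP x. f x / F) = 1" "(SUP x. g x / G) = 1"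
        using False fin by (simp_all add: F_def[symmetric] G_def[symmetric] flip: SUP_divide_ennreal)
      show "f x / F \<noteq> 0 \<Longrightarrow> \<bar>x\<bar> \<le> N" "g x / G \<noteq> 0 \<Longrightarrow> \<bar>x\<bar> \<le> N" for x using supp[of x] by auto
      fix x y
      have "f x / F * (g y / G) = f x * g y * (inverse F * inverse G)"
        by (simp add: divide_ennreal_def ac_simps)
      also have "inverse F * inverse G = (inverse c)^2"
      proof -
        have "inverse c = ennreal (inverse (sqrt (a * b)))"
          unfolding c_def using pos by (intro inverse_ennreal) auto
        moreover have "(inverse (sqrt (a * b)))^2 = inverse a * inverse b"
          using pos by (simp add: power_inverse real_sqrt_pow2)
        ultimately show ?thesis using pos by (simp add: ab inverse_ennreal ennreal_power ennreal_mult)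
      qed
      also have "f x * g y * (inverse c)^2 \<le> (h ((x + y) / 2))^2 * (inverse c)^2"
        by (intro mult_right_mono mid) auto
      also have "\<dots> = (h ((x + y) / 2) / c)^2"
        by (simp add: divide_ennreal_def power_mult_distrib)
      finally show "f x / F * (g y / G) \<le> (h ((x + y) / 2) / c)^2" .
    qed measurable
    have "(\<integral>\<^sup>+x. f x \<partial>lborel) / F * ((\<integral>\<^sup>+x. g x \<partial>lborel) / G) \<le> ((\<integral>\<^sup>+x. h x \<partial>lborel) / c)^2"
      using ennreal_am_gm[OF *] by (simp add: nn_integral_divide)
    then have "F * G * ((\<integral>\<^sup>+x. f x \<partial>lborel) / F * ((\<integral>\<^sup>+x. g x \<partial>lborel) / G)) \<le> c^2 * ((\<integral>\<^sup>+x. h x \<partial>lborel) / c)^2"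
      unfolding c by (rule mult_left_mono) simp
    moreover have "F * G * ((\<integral>\<^sup>+x. f x \<partial>lborel) / F * ((\<integral>\<^sup>+x. g x \<partial>lborel) / G))
        = (F / F * (G / G)) * ((\<integral>\<^sup>+x. f x \<partial>lborel) * (\<integral>\<^sup>+x. g x \<partial>lborel))"
      by (simp add: divide_ennreal_def ac_simps)
    moreover have "c^2 * ((\<integral>\<^sup>+x. h x \<partial>lborel) / c)^2 = (c / c)^2 * (\<integral>\<^sup>+x. h x \<partial>lborel)^2"
      by (simp add: divide_ennreal_def power_mult_distrib ac_simps)
    ultimately show ?thesis using False fin c by simp
  qed
qed

text \<open>Truncating \<open>f\<close> and \<open>g\<close> in height and support keeps the hypothesis for the same \<open>h\<close>, so monotone
convergence removes the boundedness assumptions.\<close>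

lemma prekopa_leindler_real:
  fixes f g h :: "real \<Rightarrow> ennreal"
  assumes [measurable]: "f \<in> borel_measurable borel" "g \<in> borel_measurable borel" "h \<in> borel_measurable borel"
    and mid: "\<And>x y. f x * g y \<le> (h ((x + y) / 2)) ^ 2"
  shows "(\<integral>\<^sup>+x. f x \<partial>lborel) * (\<integral>\<^sup>+x. g x \<partial>lborel) \<le> (\<integral>\<^sup>+x. h x \<partial>lborel) ^ 2"
proof -
  define T :: "(real \<Rightarrow> ennreal) \<Rightarrow> nat \<Rightarrow> real \<Rightarrow> ennreal"
    where "T f k x = min (f x) (of_nat k) * indicator {- real k..real k} x" for f k x
  have T_le: "T f k x \<le> f x" for f k x by (auto simp: T_def indicator_def)
  have T_meas[measurable]: "T f k \<in> borel_measurable borel" if [measurable]: "f \<in> borel_measurable borel" for f k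
    unfolding T_def[abs_def] by measurable
  have SUP: "(SUP k. (\<integral>\<^sup>+x. T f k x \<partial>lborel)) = (\<integral>\<^sup>+x. f x \<partial>lborel)"
    if [measurable]: "f \<in> borel_measurable borel" for f
  proof -
    have inc: "incseq (T f)"
      unfolding incseq_def le_fun_def T_def
      by (intro allI impI mult_mono min.mono) (auto simp: indicator_def)
    have "(SUP k. T f k x) = f x" for x
    proof (rule antisym)
      show "(SUP k. T f k x) \<le> f x" by (rule SUP_least) (rule T_le)
      obtain k0 where k0: "\<bar>x\<bar> \<le> real k0" using real_arch_simple by blast
      show "f x \<le> (SUP k. T f k x)"
      proof (rule le_SUP_iff[THEN iffD2], intro allI impI)
        fix y assume "y < f x"
        then have "y < top" using less_le_trans top_greatest by blast
        then obtain k1 :: nat where "y < of_nat k1" using ennreal_Ex_less_of_nat by auto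
        then have "y < T f (max k0 k1) x"
          using k0 \<open>y < f x\<close> by (auto simp: T_def indicator_def of_nat_max less_max_iff_disj abs_le_iff max_def
              intro: less_le_trans)
        then show "\<exists>k\<in>UNIV. y < T f k x" by auto
      qed
    qed
    then show ?thesis
      by (subst nn_integral_monotone_convergence_SUP[OF inc, symmetric]) auto
  qed
  have *: "(\<integral>\<^sup>+x. T f k x \<partial>lborel) * (\<integral>\<^sup>+x. T g l x \<partial>lborel) \<le> (\<integral>\<^sup>+x. h x \<partial>lborel) ^ 2" for k l
  proof (rule prekopa_leindler_bounded[where B = "real (max k l)" and N = "real (max k l)"])
    show "T f k x \<le> ennreal (real (max k l))" "T g l x \<le> ennreal (real (max k l))" for x
      by (auto simp: T_def indicator_def min_le_iff_disj simp flip: ennreal_of_nat_eq_real_of_nat)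
    show "T f k x \<noteq> 0 \<Longrightarrow> \<bar>x\<bar> \<le> real (max k l)" "T g l x \<noteq> 0 \<Longrightarrow> \<bar>x\<bar> \<le> real (max k l)" for x
      by (auto simp: T_def indicator_def split: if_splits)
    show "T f k x * T g l y \<le> (h ((x + y) / 2))\<^sup>2" for x y
      by (rule order_trans[OF mult_mono mid]) (auto intro: T_le)
  qed measurable
  show ?thesis
    unfolding SUP[of f, OF assms(1), symmetric] SUP[of g, OF assms(2), symmetric]
      SUP_mult_left_ennreal SUP_mult_right_ennreal
    by (intro SUP_least) (rule *)
qed

text \<open>The hypothesis is stated with squares so that extended nonnegative reals need no square roots. In this form it
passes from functions to their partial integrals over one coordinate, which drives the
induction on the dimension.\<close>

lemma prekopa_leindler:
  fixes f g h :: "('i \<Rightarrow> real) \<Rightarrow> ennreal"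
  assumes "finite I"
    and "f \<in> borel_measurable (PiM I (\<lambda>_. lborel))" "g \<in> borel_measurable (PiM I (\<lambda>_. lborel))"
      "h \<in> borel_measurable (PiM I (\<lambda>_. lborel))"
    and "\<And>x y. x \<in> extensional I \<Longrightarrow> y \<in> extensional I \<Longrightarrow> f x * g y \<le> (h (\<lambda>i\<in>I. (x i + y i) / 2)) ^ 2"
  shows "(\<integral>\<^sup>+x. f x \<partial>PiM I (\<lambda>_. lborel)) * (\<integral>\<^sup>+x. g x \<partial>PiM I (\<lambda>_. lborel))
    \<le> (\<integral>\<^sup>+x. h x \<partial>PiM I (\<lambda>_. lborel)) ^ 2"
  using assms
proof (induction I arbitrary: f g h rule: finite_induct)
  case empty
  then show ?case
    using empty(4)[of "\<lambda>_. undefined" "\<lambda>_. undefined"]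
    by (simp add: PiM_empty nn_integral_count_space_finite restrict_def)
next
  case (insert i I)
  interpret product_sigma_finite "\<lambda>_. lborel :: real measure" by standard
  note [measurable] = insert.prems(1-3)
  have upd: "(\<lambda>t. k (x(i := t))) \<in> borel_measurable borel"
    if "k \<in> borel_measurable (PiM (insert i I) (\<lambda>_. lborel))" "x \<in> extensional I"
    for k :: "('i \<Rightarrow> real) \<Rightarrow> ennreal" and x
    using measurable_comp[OF measurable_component_update[of x I "\<lambda>_. lborel" i] that(1)] that(2) insert.hyps(2)
    by (simp add: comp_def space_PiM PiE_def)
  have eq: "(\<integral>\<^sup>+x. k x \<partial>PiM (insert i I) (\<lambda>_. lborel))
      = (\<integral>\<^sup>+x. (\<integral>\<^sup>+t. k (x(i := t)) \<partial>lborel) \<partial>PiM I (\<lambda>_. lborel))"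
    if "k \<in> borel_measurable (PiM (insert i I) (\<lambda>_. lborel))" for k :: "('i \<Rightarrow> real) \<Rightarrow> ennreal"
    using product_nn_integral_insert[OF insert.hyps that] .
  show ?case
    unfolding eq[OF insert.prems(1)] eq[OF insert.prems(2)] eq[OF insert.prems(3)]
  proof (rule insert.IH)
    fix x y :: "'i \<Rightarrow> real" assume xy: "x \<in> extensional I" "y \<in> extensional I"
    let ?z = "\<lambda>j\<in>I. (x j + y j) / 2"
    show "(\<integral>\<^sup>+t. f (x(i := t)) \<partial>lborel) * (\<integral>\<^sup>+t. g (y(i := t)) \<partial>lborel)
      \<le> (\<integral>\<^sup>+t. h (?z(i := t)) \<partial>lborel) ^ 2"
    proof (rule prekopa_leindler_real)
      fix s t :: real
      have "(\<lambda>j\<in>insert i I. ((x(i := s)) j + (y(i := t)) j) / 2) = ?z(i := (s + t) / 2)"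
        using insert.hyps(2) by (auto simp: fun_eq_iff)
      moreover have "x(i := s) \<in> extensional (insert i I)" "y(i := t) \<in> extensional (insert i I)"
        using xy by (auto simp: extensional_def)
      ultimately show "f (x(i := s)) * g (y(i := t)) \<le> (h (?z(i := (s + t) / 2)))\<^sup>2"
        using insert.prems(4)[of "x(i := s)" "y(i := t)"] by metis
    qed (use xy insert.prems in \<open>auto intro!: upd\<close>)
  qed measurable
qed

section \<open>Intervals under a log-concave law\<close>

text \<open>For a law with a continuous density this says that the density is midpoint log-concave. Intervals of a common width
replace density values, because an inequality between their masses is what the
Prekopa-Leindler inequality yields directly.\<close>

definition midpoint_log_concave :: "real measure \<Rightarrow> bool" where
  "midpoint_log_concave M \<longleftrightarrow> (\<forall>s t w. w > 0 \<longrightarrow>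
     measure M {s..<s + w} * measure M {t..<t + w} \<le> (measure M {(s + t) / 2..<(s + t) / 2 + w})\<^sup>2)"

text \<open>If the window of width \<open>w\<close> shifted by \<open>s\<close> still has mass \<open>m / 16\<close>, then by log-concavity so have all windows shifted
by dyadic fractions of \<open>s\<close>. About \<open>|s| / w\<close> of these are disjoint, and their total mass is at most 1.\<close>

lemma (in real_distribution) midpoint_log_concave_decay:
  assumes lc: "midpoint_log_concave M" and w: "w > 0"
    and m: "m = prob {a..<a + w}" "m > 0"
    and s: "prob {a + s..<a + s + w} \<ge> m / 16"
  shows "\<bar>s\<bar> \<le> 32 * w / m"
proof (cases "\<bar>s\<bar> < w")
  case True
  have "m \<le> 1" using m by simp
  then have "w * m \<le> w * 1" using w by (intro mult_left_mono) auto
  then have "w \<le> 32 * w / m" using m(2) w by (simp add: field_simps)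
  with True show ?thesis by simp
next
  case False
  define P where "P t = prob {a + t..<a + t + w}" for t
  have mid: "P u * P v \<le> (P ((u + v) / 2))\<^sup>2" for u v
  proof -
    have "((a + u) + (a + v)) / 2 = a + (u + v) / 2" by (simp add: field_simps)
    then show ?thesis
      using lc w unfolding midpoint_log_concave_def P_def by metis
  qed
  have P0: "P 0 = m" and Ps: "P s \<ge> m / 16" using m s by (simp_all add: P_def)
  \<comment> \<open>\<open>P\<close> is at least \<open>m / 16\<close> at \<open>0\<close> and at \<open>s\<close>, and this property passes to midpoints.\<close>
  have dyadic: "P (s * real j / 2 ^ r) \<ge> m / 16" if "j \<le> 2 ^ r" for r j
    using that
  proof (induction r arbitrary: j)
    case 0
    then have "j = 0 \<or> j = 1" by auto
    then show ?case using P0 Ps m by auto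
  next
    case (Suc r)
    show ?case
    proof (cases "even j")
      case True
      then obtain k where k: "j = 2 * k" by blast
      then show ?thesis using Suc.IH[of k] Suc.prems by simp
    next
      case False
      then obtain k where k: "j = 2 * k + 1" by (auto elim: oddE)
      then have "k < 2 ^ r" using Suc.prems by auto
      then have "m / 16 \<le> P (s * real k / 2 ^ r)" "m / 16 \<le> P (s * real (Suc k) / 2 ^ r)"
        by (metis Suc.IH less_imp_le, metis Suc.IH Suc_leI)
      then have "(m / 16)\<^sup>2 \<le> P (s * real k / 2 ^ r) * P (s * real (Suc k) / 2 ^ r)"
        unfolding power2_eq_square using m by (intro mult_mono) auto
      also have "\<dots> \<le> (P ((s * real k / 2 ^ r + s * real (Suc k) / 2 ^ r) / 2))\<^sup>2" by (rule mid)
      also have "(s * real k / 2 ^ r + s * real (Suc k) / 2 ^ r) / 2 = s * real j / 2 ^ Suc r"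
        by (simp add: k field_simps)
      finally show ?thesis
        by (rule power2_le_imp_le) (simp add: P_def)
    qed
  qed
  \<comment> \<open>Choose the finest dyadic grid whose spacing \<open>D\<close> is still at least \<open>w\<close>, so that \<open>w \<le> D < 2 * w\<close>.\<close>
  have "\<exists>r. \<bar>s\<bar> / 2 ^ r < w"
  proof -
    obtain r where "\<bar>s\<bar> / w < 2 ^ r" using real_arch_pow[of 2 "\<bar>s\<bar> / w"] by auto
    then show ?thesis using w by (auto simp: field_simps)
  qed
  then obtain k where k: "\<bar>s\<bar> / 2 ^ k < w" "\<And>r. r < k \<Longrightarrow> \<not> \<bar>s\<bar> / 2 ^ r < w"
    using exists_least_iff[of "\<lambda>r. \<bar>s\<bar> / 2 ^ r < w"] by auto
  then obtain r where r: "k = Suc r" using False by (cases k) auto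
  define D where "D = \<bar>s\<bar> / 2 ^ r"
  have D: "w \<le> D" "\<bar>s\<bar> < 2 * 2 ^ r * w" using k(1) k(2)[of r] r w by (auto simp: D_def field_simps)
  define I where "I j = {a + s * real j / 2 ^ r..<a + s * real j / 2 ^ r + w}" for j
  have disj: "disjoint_family_on I {..<2 ^ r}"
    unfolding disjoint_family_on_def
  proof (intro ballI impI)
    fix i j :: nat assume "i \<noteq> j"
    then have "1 \<le> \<bar>real i - real j\<bar>" by auto
    then have "w \<le> D * \<bar>real i - real j\<bar>" using D(1) w mult_mono[of w D 1 "\<bar>real i - real j\<bar>"] by simp
    also have "\<dots> = \<bar>s * real i / 2 ^ r - s * real j / 2 ^ r\<bar>"
      by (simp add: D_def abs_mult flip: right_diff_distrib diff_divide_distrib)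
    finally show "I i \<inter> I j = {}" by (auto simp: I_def)
  qed
  have "2 ^ r * (m / 16) \<le> (\<Sum>j<2 ^ r. prob (I j))"
    using sum_bounded_below[of "{..<2 ^ r}" "m / 16" "\<lambda>j. prob (I j)"] dyadic[of _ r]
    by (simp add: I_def P_def)
  also have "\<dots> = prob (\<Union>j<2 ^ r. I j)"
    by (intro finite_measure_finite_Union[symmetric] disj) (auto simp: I_def)
  also have "\<dots> \<le> 1" by simp
  finally have "2 ^ r * m \<le> 16" by simp
  then have "(2 * 2 ^ r * w) * m \<le> 32 * w" using w by (simp add: field_simps)
  then have "\<bar>s\<bar> * m \<le> 32 * w" using D(2) m by (smt (verit) mult_right_mono)
  then show ?thesis using m by (simp add: field_simps)
qed

lemma (in real_distribution) window_fubini: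
  fixes g :: "real \<Rightarrow> ennreal"
  assumes [measurable]: "g \<in> borel_measurable borel"
  shows "(\<integral>\<^sup>+s. g s * ennreal (prob {a + s..<a + s + w}) \<partial>lborel)
       = (\<integral>\<^sup>+x. (\<integral>\<^sup>+s. g s * indicator {x - a - w<..x - a} s \<partial>lborel) \<partial>M)"
proof -
  interpret pair_sigma_finite lborel M by standard
  have "(\<integral>\<^sup>+s. g s * ennreal (prob {a + s..<a + s + w}) \<partial>lborel)
      = (\<integral>\<^sup>+s. (\<integral>\<^sup>+x. g s * indicator {x - a - w<..x - a} s \<partial>M) \<partial>lborel)"
  proof (rule nn_integral_cong)
    fix s
    have "(\<integral>\<^sup>+x. g s * indicator {x - a - w<..x - a} s \<partial>M) = (\<integral>\<^sup>+x. g s * indicator {a + s..<a + s + w} x \<partial>M)"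
      by (intro nn_integral_cong) (auto simp: indicator_def)
    also have "\<dots> = g s * ennreal (prob {a + s..<a + s + w})"
      by (simp add: nn_integral_cmult emeasure_eq_measure)
    finally show "g s * ennreal (prob {a + s..<a + s + w}) = (\<integral>\<^sup>+x. g s * indicator {x - a - w<..x - a} s \<partial>M)" ..
  qed
  also have "\<dots> = (\<integral>\<^sup>+x. (\<integral>\<^sup>+s. g s * indicator {x - a - w<..x - a} s \<partial>lborel) \<partial>M)"
  proof (rule Fubini'[symmetric])
    have "(\<lambda>(s, x). g s * indicator {(s, x). x - a - w < s \<and> s \<le> x - a} (s, x)) \<in> borel_measurable (lborel \<Otimes>\<^sub>M M)"
      by measurable
    then show "(\<lambda>(s, x). g s * indicator {x - a - w<..x - a} s) \<in> borel_measurable (lborel \<Otimes>\<^sub>M M)"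
      by (rule measurable_cong[THEN iffD1, rotated]) (auto simp: indicator_def)
  qed
  finally show ?thesis .
qed

text \<open>Let \<open>P s\<close> be the mass of the window shifted by \<open>s\<close>, so \<open>P 0 = m\<close>. The decay lemma gives \<open>P u < m / 16\<close>
for \<open>|u| > R\<close>, and log-concavity between \<open>0\<close> and \<open>2 * u\<close> turns this into \<open>P (2 * u) \<le> P u / 16\<close>. By the
substitution \<open>s = 2 * u\<close>, the integral of \<open>s\<^sup>2 * P s\<close> over \<open>|s| > 2 * R\<close> is at most half of the one
over \<open>|s| > R\<close>, so the whole integral is controlled by the range \<open>|s| \<le> 2 * R\<close>. The second moment
about \<open>a\<close> is comparable to that integral, since \<open>P\<close> is the law smeared over a width \<open>w\<close>.\<close>

lemma (in real_distribution) midpoint_log_concave_second_moment: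
  assumes lc: "midpoint_log_concave M" and w: "w > 0"
    and m: "m = prob {a..<a + w}" "m > 0"
    and bdd: "AE x in M. \<bar>x\<bar> \<le> B"
  shows "(\<integral>\<^sup>+x. ennreal ((x - a)\<^sup>2) \<partial>M) \<le> ennreal (18432 * (w / m)\<^sup>2)"
proof -
  define P where "P t = prob {a + t..<a + t + w}" for t
  have [measurable]: "P \<in> borel_measurable borel"
  proof -
    have "P = (\<lambda>t. prob {..<a + t + w} - prob {..<a + t})"
    proof
      fix t
      have "prob {..<a + t + w} = prob ({..<a + t} \<union> {a + t..<a + t + w})"
        using w by (intro arg_cong[of _ _ prob]) auto
      also have "\<dots> = prob {..<a + t} + P t"
        unfolding P_def by (rule finite_measure_Union) auto
      finally show "P t = prob {..<a + t + w} - prob {..<a + t}" by simp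
    qed
    moreover have "(\<lambda>t. prob {..<a + t + w}) \<in> borel_measurable borel" "(\<lambda>t. prob {..<a + t}) \<in> borel_measurable borel"
      by (intro borel_measurable_mono monoI finite_measure_mono; auto)+
    ultimately show ?thesis by simp
  qed
  define R where "R = 32 * w / m"
  have "m \<le> 1" using m by simp
  then have "w * m \<le> w * 1" using w by (intro mult_left_mono) auto
  then have R: "w \<le> R" "R > 0" using m(2) w by (auto simp: R_def field_simps)
  define J where "J S = (\<integral>\<^sup>+s. ennreal (s\<^sup>2 * P s) * indicator S s \<partial>lborel)" for S
  have Jun: "J (S \<union> T) = J S + J T" if "S \<inter> T = {}" "S \<in> sets borel" "T \<in> sets borel" for S T
    unfolding J_def using that
    by (subst nn_integral_add[symmetric]) (auto intro!: nn_integral_cong simp: indicator_def)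
  have Pint: "(\<integral>\<^sup>+s. ennreal (P s) \<partial>lborel) = ennreal w"
    using window_fubini[of "\<lambda>_. 1" a w] w by (simp add: P_def emeasure_space_1[unfolded space_eq_univ])
  have J_le: "J S \<le> ennreal (r\<^sup>2 * w)" if "\<And>s. s \<in> S \<Longrightarrow> P s \<noteq> 0 \<Longrightarrow> \<bar>s\<bar> \<le> r" "r \<ge> 0" for S r
  proof -
    have "J S \<le> (\<integral>\<^sup>+s. ennreal (r\<^sup>2) * ennreal (P s) \<partial>lborel)"
      unfolding J_def
    proof (rule nn_integral_mono)
      fix s show "ennreal (s\<^sup>2 * P s) * indicator S s \<le> ennreal (r\<^sup>2) * ennreal (P s)"
        using that(1)[of s] abs_le_square_iff[of s r] that(2)
        by (cases "s \<in> S"; cases "P s = 0") (auto simp: P_def ennreal_mult[symmetric] intro!: ennreal_leI mult_right_mono)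
    qed
    also have "\<dots> = ennreal (r\<^sup>2 * w)"
      using w by (subst nn_integral_cmult) (auto simp: Pint ennreal_mult)
    finally show ?thesis .
  qed
  have Pzero: "P s = 0" if "\<bar>s\<bar> > \<bar>a\<bar> + \<bar>w\<bar> + \<bar>B\<bar>" for s
  proof -
    have "AE x in M. x \<notin> {a + s..<a + s + w}"
      using bdd by eventually_elim (use that in auto)
    then show ?thesis unfolding P_def by (subst (asm) prob_eq_0[symmetric]) auto
  qed
  have Jfin: "J S < top" for S
  proof -
    have "J S \<le> ennreal ((\<bar>a\<bar> + \<bar>w\<bar> + \<bar>B\<bar>)\<^sup>2 * w)" using Pzero by (intro J_le) (auto simp: not_less[symmetric])
    then show ?thesis by (auto intro: le_less_trans)
  qed
  have decay: "P (2 * u) \<le> P u / 16" if "\<bar>u\<bar> > R" for u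
  proof -
    have "P u < m / 16"
      using midpoint_log_concave_decay[OF lc w m, of u] that by (auto simp: R_def P_def not_le[symmetric])
    moreover have "P 0 * P (2 * u) \<le> (P u)\<^sup>2"
    proof -
      have "((a + 0) + (a + 2 * u)) / 2 = a + u" by (simp add: field_simps)
      then show ?thesis
        using lc w unfolding midpoint_log_concave_def P_def by metis
    qed
    moreover have "P 0 = m" by (simp add: P_def m)
    moreover have "P u * P u \<le> m / 16 * P u"
      using \<open>P u < m / 16\<close> by (intro mult_right_mono) (auto simp: P_def)
    ultimately have "m * P (2 * u) \<le> m / 16 * P u"
      unfolding power2_eq_square by (metis order_trans)
    also have "\<dots> = m * (P u / 16)" by simp
    finally have "m * P (2 * u) \<le> m * (P u / 16)" .
    then show ?thesis using m(2) by (rule mult_left_le_imp_le)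
  qed
  \<comment> \<open>The substitution contributes the factor \<open>2 * 2\<^sup>2 = 8\<close>, which the factor \<open>1/16\<close> outweighs.\<close>
  have half: "2 * J {s. \<bar>s\<bar> > 2 * R} \<le> J {s. \<bar>s\<bar> > R}"
  proof -
    have "J {s. \<bar>s\<bar> > 2 * R} = 2 * (\<integral>\<^sup>+u. ennreal ((2 * u)\<^sup>2 * P (2 * u)) * indicator {s. \<bar>s\<bar> > 2 * R} (2 * u) \<partial>lborel)"
      unfolding J_def by (subst nn_integral_real_affine[where c = 2 and t = 0]) auto
    then have "2 * J {s. \<bar>s\<bar> > 2 * R} = (\<integral>\<^sup>+u. 4 * (ennreal ((2 * u)\<^sup>2 * P (2 * u)) * indicator {s. \<bar>s\<bar> > 2 * R} (2 * u)) \<partial>lborel)"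
      by (subst nn_integral_cmult) (auto simp: mult.assoc[symmetric])
    also have "\<dots> \<le> J {s. \<bar>s\<bar> > R}"
      unfolding J_def
    proof (rule nn_integral_mono)
      fix u :: real
      show "4 * (ennreal ((2 * u)\<^sup>2 * P (2 * u)) * indicator {s. \<bar>s\<bar> > 2 * R} (2 * u))
        \<le> ennreal (u\<^sup>2 * P u) * indicator {s. \<bar>s\<bar> > R} u"
      proof (cases "\<bar>u\<bar> > R")
        case True
        have "4 * ((2 * u)\<^sup>2 * P (2 * u)) \<le> u\<^sup>2 * P u"
          using mult_left_mono[OF decay[OF True], of "16 * u\<^sup>2"] by (simp add: power_mult_distrib)
        then have "ennreal (4 * ((2 * u)\<^sup>2 * P (2 * u))) \<le> ennreal (u\<^sup>2 * P u)" by (rule ennreal_leI)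
        moreover have "ennreal (4 * ((2 * u)\<^sup>2 * P (2 * u))) = 4 * ennreal ((2 * u)\<^sup>2 * P (2 * u))"
          by (subst ennreal_mult) (auto simp: P_def)
        moreover have "indicator {s. \<bar>s\<bar> > 2 * R} (2 * u) = (1::ennreal)" "indicator {s. \<bar>s\<bar> > R} u = (1::ennreal)"
          using True by auto
        ultimately show ?thesis by (simp only: mult_1_right)
      qed auto
    qed
    finally show ?thesis .
  qed
  have "J {s. \<bar>s\<bar> > R} = J ({s. R < \<bar>s\<bar> \<and> \<bar>s\<bar> \<le> 2 * R} \<union> {s. \<bar>s\<bar> > 2 * R})"
    using R by (intro arg_cong[of _ _ J]) auto
  also have "\<dots> = J {s. R < \<bar>s\<bar> \<and> \<bar>s\<bar> \<le> 2 * R} + J {s. \<bar>s\<bar> > 2 * R}"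
    by (rule Jun) auto
  finally have split: "J {s. \<bar>s\<bar> > R} = J {s. R < \<bar>s\<bar> \<and> \<bar>s\<bar> \<le> 2 * R} + J {s. \<bar>s\<bar> > 2 * R}" .
  have "J {s. \<bar>s\<bar> > 2 * R} + J {s. \<bar>s\<bar> > 2 * R} \<le> J {s. \<bar>s\<bar> > 2 * R} + J {s. R < \<bar>s\<bar> \<and> \<bar>s\<bar> \<le> 2 * R}"
    using half unfolding split mult_2[of "J {s. \<bar>s\<bar> > 2 * R}"] add.commute[of "J {s. R < \<bar>s\<bar> \<and> \<bar>s\<bar> \<le> 2 * R}"] .
  \<comment> \<open>This cancellation is where the support bound is used: it makes the integrals finite.\<close>
  then have "J {s. \<bar>s\<bar> > 2 * R} \<le> J {s. R < \<bar>s\<bar> \<and> \<bar>s\<bar> \<le> 2 * R}"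
    using Jfin[of "{s. \<bar>s\<bar> > 2 * R}"] unfolding ennreal_add_left_cancel_le by auto
  also have "\<dots> \<le> ennreal ((2 * R)\<^sup>2 * w)" using R by (intro J_le) auto
  finally have tail: "J {s. \<bar>s\<bar> > 2 * R} \<le> ennreal ((2 * R)\<^sup>2 * w)" .
  have "J UNIV = J ({s. \<bar>s\<bar> \<le> 2 * R} \<union> {s. \<bar>s\<bar> > 2 * R})"
    by (intro arg_cong[of _ _ J]) auto
  also have "\<dots> = J {s. \<bar>s\<bar> \<le> 2 * R} + J {s. \<bar>s\<bar> > 2 * R}"
    by (rule Jun) auto
  also have "\<dots> \<le> ennreal ((2 * R)\<^sup>2 * w) + ennreal ((2 * R)\<^sup>2 * w)"
    using R by (intro add_mono tail J_le) auto
  also have "\<dots> = ennreal (8 * R\<^sup>2 * w)"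
    using R w by (simp add: power_mult_distrib flip: ennreal_plus)
  finally have J: "J UNIV \<le> ennreal (8 * R\<^sup>2 * w)" .

  \<comment> \<open>A point \<open>x\<close> lies in the window shifted by \<open>s\<close> exactly when \<open>s\<close> is in an interval of length \<open>w\<close> ending at \<open>x - a\<close>,
and there \<open>(x - a)\<^sup>2 \<le> 2 * s\<^sup>2 + 2 * w\<^sup>2\<close>.\<close>
  have "ennreal w * (\<integral>\<^sup>+x. ennreal ((x - a)\<^sup>2) \<partial>M) = (\<integral>\<^sup>+x. (\<integral>\<^sup>+s. ennreal ((x - a)\<^sup>2) * indicator {x - a - w<..x - a} s \<partial>lborel) \<partial>M)"
    using w by (simp add: nn_integral_cmult mult.commute)
  also have "\<dots> \<le> (\<integral>\<^sup>+x. (\<integral>\<^sup>+s. ennreal (2 * s\<^sup>2 + 2 * w\<^sup>2) * indicator {x - a - w<..x - a} s \<partial>lborel) \<partial>M)"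
  proof (intro nn_integral_mono)
    fix x s
    show "ennreal ((x - a)\<^sup>2) * indicator {x - a - w<..x - a} s
        \<le> ennreal (2 * s\<^sup>2 + 2 * w\<^sup>2) * indicator {x - a - w<..x - a} s"
    proof (cases "s \<in> {x - a - w<..x - a}")
      case True
      define d where "d = x - a - s"
      have "d\<^sup>2 \<le> w\<^sup>2" using True by (intro power_mono) (auto simp: d_def)
      moreover have "(x - a)\<^sup>2 = (s + d)\<^sup>2" by (simp add: d_def)
      moreover have "(s + d)\<^sup>2 + (s - d)\<^sup>2 = 2 * s\<^sup>2 + 2 * d\<^sup>2" by (simp add: power2_eq_square algebra_simps)
      ultimately have "(x - a)\<^sup>2 \<le> 2 * s\<^sup>2 + 2 * w\<^sup>2" by (smt (verit) zero_le_power2)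
      then show ?thesis by (intro mult_right_mono ennreal_leI) auto
    qed auto
  qed
  also have "\<dots> = (\<integral>\<^sup>+s. ennreal (2 * s\<^sup>2 + 2 * w\<^sup>2) * ennreal (P s) \<partial>lborel)"
    unfolding P_def by (rule window_fubini[symmetric]) measurable
  also have "\<dots> = (\<integral>\<^sup>+s. 2 * (ennreal (s\<^sup>2 * P s) * indicator UNIV s) + ennreal (2 * w\<^sup>2) * ennreal (P s) \<partial>lborel)"
    by (intro nn_integral_cong)
      (simp add: P_def distrib_right ennreal_plus ennreal_mult mult.assoc del: ennreal_plus_if)
  also have "\<dots> = 2 * J UNIV + ennreal (2 * w\<^sup>2) * ennreal w"
    by (simp add: nn_integral_add nn_integral_cmult Pint J_def)
  also have "\<dots> \<le> 2 * ennreal (8 * R\<^sup>2 * w) + ennreal (2 * w\<^sup>2) * ennreal w"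
    by (intro add_right_mono mult_left_mono J) auto
  also have "\<dots> = ennreal (w * (16 * R\<^sup>2 + 2 * w\<^sup>2))"
    using w R by (simp add: ennreal_mult'[symmetric] algebra_simps flip: ennreal_plus ennreal_numeral)
  also have "\<dots> \<le> ennreal (w * (18 * R\<^sup>2))"
    using w R power_mono[of w R 2] by (intro ennreal_leI mult_left_mono) auto
  also have "\<dots> = ennreal w * ennreal (18432 * (w / m)\<^sup>2)"
  proof -
    have "18 * R\<^sup>2 = 18432 * (w / m)\<^sup>2" by (simp add: R_def power_divide power_mult_distrib)
    then show ?thesis using w ennreal_mult'[of w "18 * R\<^sup>2"] by simp
  qed
  finally show ?thesis
    using w by (subst (asm) ennreal_mult_le_mult_iff) auto
qed

text \<open>An interval with too much mass would force the second moment about its left end below \<open>V\<close>. The second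
moment bound concerns half-open intervals of positive width, so \<open>{a..b}\<close> is enlarged by a
small amount. The case \<open>a = b\<close> shows that the law has no atoms. The constant comes from \<open>18432 \<le> 136\<^sup>2\<close>.\<close>

lemma (in real_distribution) midpoint_log_concave_interval_bound:
  assumes lc: "midpoint_log_concave M"
    and bdd: "AE x in M. \<bar>x\<bar> \<le> B"
    and V: "V > 0" "\<And>c. ennreal V \<le> (\<integral>\<^sup>+x. ennreal ((x - c)\<^sup>2) \<partial>M)" and "a \<le> b"
  shows "prob {a..b} \<le> 136 * (b - a) / sqrt V"
proof (rule field_le_epsilon)
  fix e :: real assume "e > 0"
  define w where "w = b - a + e * sqrt V / 136"
  define m where "m = prob {a..<a + w}"
  have w: "w > 0" "b < a + w" using \<open>e > 0\<close> V \<open>a \<le> b\<close> by (auto simp: w_def intro: add_nonneg_pos)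
  have "prob {a..b} \<le> m" unfolding m_def using w by (intro finite_measure_mono) auto
  also have "m \<le> 136 * w / sqrt V"
  proof (cases "m = 0")
    case True then show ?thesis using w V by simp
  next
    case False
    then have "m > 0" by (simp add: m_def zero_less_measure_iff)
    have "ennreal V \<le> ennreal (18432 * (w / m)\<^sup>2)"
      using V(2)[of a] midpoint_log_concave_second_moment[OF lc w(1) m_def \<open>m > 0\<close> bdd] by (rule order_trans)
    then have "V \<le> 18432 * (w / m)\<^sup>2" by (simp add: ennreal_le_iff)
    also have "\<dots> \<le> (136 * (w / m))\<^sup>2" unfolding power_mult_distrib by (intro mult_right_mono) auto
    finally have "sqrt V \<le> 136 * (w / m)"
      using w \<open>m > 0\<close> by (intro real_le_lsqrt) auto
    then show ?thesis using V \<open>m > 0\<close> by (simp add: field_simps)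
  qed
  also have "\<dots> = 136 * (b - a) / sqrt V + e" using V by (simp add: w_def field_simps)
  finally show "prob {a..b} \<le> 136 * (b - a) / sqrt V + e" .
qed

section \<open>Convex bodies and the symmetries of Lebesgue measure\<close>

lemma rational_interval_in_open:
  fixes x :: real assumes "open V" "x \<in> V"
  shows "\<exists>l\<in>\<rat>. \<exists>r\<in>\<rat>. l < x \<and> x < r \<and> {l<..<r} \<subseteq> V"
proof -
  obtain e where e: "e > 0" "ball x e \<subseteq> V" using assms openE by blast
  obtain l where l: "l \<in> \<rat>" "x - e < l" "l < x" using Rats_dense_in_real[of "x - e" x] e by auto
  obtain r where r: "r \<in> \<rat>" "x < r" "r < x + e" using Rats_dense_in_real[of x "x + e"] e by auto
  have "{l<..<r} \<subseteq> ball x e" using l r by (auto simp: ball_def dist_real_def)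
  then have "{l<..<r} \<subseteq> V" using e(2) by (rule order_trans)
  then show ?thesis using l r by (intro bexI[of _ l] bexI[of _ r] conjI) auto
qed

lemma openin_powertop_box:
  assumes "finite I" "openin (powertop_real I) U" "x \<in> U"
  shows "\<exists>q\<in>I \<rightarrow>\<^sub>E \<rat> \<times> \<rat>. x \<in> (\<Pi>\<^sub>E i\<in>I. {fst (q i)<..<snd (q i)}) \<and> (\<Pi>\<^sub>E i\<in>I. {fst (q i)<..<snd (q i)}) \<subseteq> U"
proof -
  obtain V where V: "\<forall>i\<in>I. openin euclideanreal (V i)" "x \<in> Pi\<^sub>E I V" "Pi\<^sub>E I V \<subseteq> U"
    using assms(2,3) by (auto simp: openin_product_topology_alt)
  have "\<forall>i\<in>I. \<exists>p\<in>\<rat> \<times> \<rat>. fst p < x i \<and> x i < snd p \<and> {fst p<..<snd p} \<subseteq> V i"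
  proof
    fix i assume "i \<in> I"
    then have "open (V i)" "x i \<in> V i" using V by auto
    from rational_interval_in_open[OF this] obtain l r
      where "l \<in> \<rat>" "r \<in> \<rat>" "l < x i" "x i < r" "{l<..<r} \<subseteq> V i" by auto
    then show "\<exists>p\<in>\<rat> \<times> \<rat>. fst p < x i \<and> x i < snd p \<and> {fst p<..<snd p} \<subseteq> V i"
      by (intro bexI[of _ "(l, r)"]) auto
  qed
  then obtain p where p: "\<And>i. i \<in> I \<Longrightarrow> p i \<in> \<rat> \<times> \<rat> \<and> fst (p i) < x i \<and> x i < snd (p i) \<and> {fst (p i)<..<snd (p i)} \<subseteq> V i"
    by metis
  have "(\<Pi>\<^sub>E i\<in>I. {fst (restrict p I i)<..<snd (restrict p I i)}) \<subseteq> Pi\<^sub>E I V"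
    using p by (intro PiE_mono) auto
  moreover have "x \<in> (\<Pi>\<^sub>E i\<in>I. {fst (restrict p I i)<..<snd (restrict p I i)})"
    using p V(2) by (auto simp: PiE_def Pi_def)
  moreover have "restrict p I \<in> I \<rightarrow>\<^sub>E \<rat> \<times> \<rat>" using p by auto
  ultimately show ?thesis using V(3) by (intro bexI[of _ "restrict p I"] conjI) (assumption | rule order_trans)+
qed

text \<open>An open set is the union of the countably many rational boxes that it contains.\<close>

lemma openin_powertop_measurable:
  assumes "finite I" "openin (powertop_real I) U"
  shows "U \<in> sets (PiM I (\<lambda>_. lborel))"
proof -
  define box where "box q = (\<Pi>\<^sub>E i\<in>I. {fst (q i)<..<snd (q i)} :: real set)" for q
  define Q where "Q = {q \<in> I \<rightarrow>\<^sub>E \<rat> \<times> \<rat>. box q \<subseteq> U}"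
  have "countable (I \<rightarrow>\<^sub>E (\<rat> \<times> \<rat> :: (real \<times> real) set))"
    using assms(1) by (intro countable_PiE countable_SIGMA countable_rat)
  then have "countable Q" unfolding Q_def by (rule countable_subset[rotated]) auto
  moreover have "U = (\<Union>q\<in>Q. box q)"
  proof
    show "U \<subseteq> (\<Union>q\<in>Q. box q)" 
    proof
      fix x assume "x \<in> U"
      from openin_powertop_box[OF assms this] show "x \<in> (\<Union>q\<in>Q. box q)" by (auto simp: Q_def box_def)
    qed
  qed (auto simp: Q_def)
  moreover have "box q \<in> sets (PiM I (\<lambda>_. lborel))" for q
    unfolding box_def using assms(1) by (intro sets_PiM_I_finite) auto
  ultimately show ?thesis by (metis sets.countable_UN'')
qed

text \<open>The second interpretation makes \<open>vol n\<close> known to be sigma-finite, which the uses of Fubini rely on.\<close>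

interpretation lb: product_sigma_finite "\<lambda>_::nat. lborel :: real measure" by standard
interpretation lbn: finite_product_sigma_finite "\<lambda>_::nat. lborel :: real measure" "{..<n}" for n by standard auto

lemma convex_body_measurable:
  assumes "convex_body n K" shows "K \<in> sets (vol n)"
proof -
  have "compactin (powertop_real {..<n}) K" using assms unfolding convex_body_def by blast
  then have "closedin (powertop_real {..<n}) K"
    by (intro compactin_imp_closedin) (simp_all add: Hausdorff_space_product_topology)
  then have "K \<subseteq> space (vol n)" "openin (powertop_real {..<n}) (space (vol n) - K)"
    by (auto simp: closedin_def space_PiM)
  then have "space (vol n) - (space (vol n) - K) \<in> sets (vol n)"
    by (intro sets.compl_sets openin_powertop_measurable) auto
  then show ?thesis using \<open>K \<subseteq> space (vol n)\<close> by (simp add: double_diff)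
qed

lemma convex_body_bounded:
  assumes "convex_body n K" shows "\<exists>B\<ge>0. \<forall>x\<in>K. \<forall>i<n. \<bar>x i\<bar> \<le> B"
proof -
  have K: "compactin (powertop_real {..<n}) K" using assms unfolding convex_body_def by (rule conjunct1)
  have "\<exists>B. \<forall>y\<in>(\<lambda>x. x i) ` K. \<bar>y\<bar> \<le> B" if "i < n" for i
  proof -
    have "continuous_map (powertop_real {..<n}) euclideanreal (\<lambda>x. x i)"
      using continuous_map_product_projection[of i "{..<n}" "\<lambda>_. euclideanreal"] that by simp
    from image_compactin[OF K this] have "compact ((\<lambda>x. x i) ` K)" by (simp only: compactin_euclidean_iff)
    then have "bounded ((\<lambda>x. x i) ` K)" by (rule compact_imp_bounded)
    then show ?thesis unfolding bounded_real .
  qed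
  then obtain B where B: "\<And>i y. i < n \<Longrightarrow> y \<in> (\<lambda>x. x i) ` K \<Longrightarrow> \<bar>y\<bar> \<le> B i" by metis
  have "\<bar>x i\<bar> \<le> (\<Sum>i<n. \<bar>B i\<bar>)" if "x \<in> K" "i < n" for x i
  proof -
    have "\<bar>x i\<bar> \<le> B i" using B[of i "x i"] that by simp
    also have "B i \<le> \<bar>B i\<bar>" by simp
    also have "\<bar>B i\<bar> \<le> (\<Sum>i<n. \<bar>B i\<bar>)" using that by (intro member_le_sum) auto
    finally show ?thesis .
  qed
  then show ?thesis by (intro exI[of _ "\<Sum>i<n. \<bar>B i\<bar>"] conjI sum_nonneg) auto
qed

lemma convex_body_positive:
  assumes "convex_body n K" shows "emeasure (vol n) K > 0"
proof -
  let ?U = "powertop_real {..<n} interior_of K"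
  obtain x where "x \<in> ?U" using assms unfolding convex_body_def by blast
  from openin_powertop_box[OF _ openin_interior_of this]
  obtain q where q: "x \<in> (\<Pi>\<^sub>E i\<in>{..<n}. {fst (q i)<..<snd (q i)})"
      "(\<Pi>\<^sub>E i\<in>{..<n}. {fst (q i)<..<snd (q i)}) \<subseteq> ?U" by auto
  have lt: "fst (q i) < snd (q i)" if "i < n" for i
    using PiE_mem[OF q(1), of i] that by auto
  have "0 < (\<Prod>i<n. ennreal (snd (q i) - fst (q i)))"
    using lt by (subst prod_ennreal) (auto intro!: prod_pos simp: less_imp_le)
  also have "\<dots> = emeasure (vol n) (\<Pi>\<^sub>E i\<in>{..<n}. {fst (q i)<..<snd (q i)})"
    using lt by (subst lb.emeasure_PiM) (auto intro!: prod.cong simp: less_imp_le)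
  also have "\<dots> \<le> emeasure (vol n) K"
    using order_trans[OF q(2) interior_of_subset] convex_body_measurable[OF assms] by (rule emeasure_mono)
  finally show ?thesis .
qed

lemma emeasure_hyperplane:
  assumes "i < n" shows "emeasure (vol n) {x \<in> space (vol n). x i = c} = 0"
proof -
  have "{x \<in> space (vol n). x i = c} = (\<Pi>\<^sub>E j\<in>{..<n}. if j = i then {c} else UNIV)"
    using assms by (auto simp: space_PiM PiE_def Pi_def split: if_splits)
  also have "emeasure (vol n) \<dots> = (\<Prod>j<n. emeasure lborel (if j = i then {c} else UNIV))"
    by (subst lb.emeasure_PiM) auto
  also have "\<dots> = 0" using assms by (intro prod_zero) (auto intro!: bexI[of _ i])
  finally show ?thesis .
qed

text \<open>Covers both translations and reflections in coordinate hyperplanes.\<close>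

lemma nn_integral_vol_affine:
  assumes [measurable]: "f \<in> borel_measurable (vol n)" and e: "\<And>i. i < n \<Longrightarrow> \<bar>e i\<bar> = 1"
  shows "(\<integral>\<^sup>+x. f (\<lambda>i\<in>{..<n}. c i + e i * x i) \<partial>vol n) = (\<integral>\<^sup>+x. f x \<partial>vol n)"
proof -
  let ?T = "\<lambda>x. \<lambda>i\<in>{..<n}. c i + e i * x i"
  have T[measurable]: "?T \<in> measurable (vol n) (vol n)" by measurable
  have "distr (vol n) (vol n) ?T = vol n"
  proof (rule lb.PiM_eqI)
    fix A :: "nat \<Rightarrow> real set" assume "\<And>i. i \<in> {..<n} \<Longrightarrow> A i \<in> sets lborel"
    then have A: "\<And>i. i < n \<Longrightarrow> A i \<in> sets borel" by simp
    have m: "{t. c i + e i * t \<in> A i} \<in> sets borel" if "i < n" for i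
    proof -
      note [measurable] = A[OF that]
      show ?thesis by measurable
    qed
    have "emeasure (distr (vol n) (vol n) ?T) (Pi\<^sub>E {..<n} A) = emeasure (vol n) (?T -` Pi\<^sub>E {..<n} A \<inter> space (vol n))"
      using A by (intro emeasure_distr T sets_PiM_I_finite) auto
    also have "?T -` Pi\<^sub>E {..<n} A \<inter> space (vol n) = (\<Pi>\<^sub>E i\<in>{..<n}. {t. c i + e i * t \<in> A i})"
      by (auto simp: space_PiM PiE_def Pi_def extensional_def)
    also have "emeasure (vol n) \<dots> = (\<Prod>i<n. emeasure lborel {t. c i + e i * t \<in> A i})"
      using m by (subst lb.emeasure_PiM) auto
    also have "\<dots> = (\<Prod>i<n. emeasure lborel (A i))"
    proof (rule prod.cong)
      fix i assume "i \<in> {..<n}"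
      then have i: "i < n" by simp
      note [measurable] = A[OF i] m[OF i]
      have "emeasure lborel (A i) = (\<integral>\<^sup>+t. indicator (A i) t \<partial>lborel)" by simp
      also have "\<dots> = (\<integral>\<^sup>+t. indicator (A i) (c i + e i * t) \<partial>lborel)"
        using e[OF i] by (subst nn_integral_real_affine[where c = "e i" and t = "c i"]) auto
      also have "\<dots> = (\<integral>\<^sup>+t. indicator {t. c i + e i * t \<in> A i} t \<partial>lborel)"
        by (intro nn_integral_cong) (auto simp: indicator_def)
      finally show "emeasure lborel {t. c i + e i * t \<in> A i} = emeasure lborel (A i)" by simp
    qed auto
    finally show "emeasure (distr (vol n) (vol n) ?T) (Pi\<^sub>E {..<n} A) = (\<Prod>i<n. emeasure lborel (A i))" .
  qed auto
  then have "(\<integral>\<^sup>+x. f x \<partial>vol n) = (\<integral>\<^sup>+x. f x \<partial>distr (vol n) (vol n) ?T)" by simp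
  also have "\<dots> = (\<integral>\<^sup>+x. f (?T x) \<partial>vol n)" by (subst nn_integral_distr) auto
  finally show ?thesis ..
qed

lemma nn_integral_vol_permute:
  assumes [measurable]: "f \<in> borel_measurable (vol n)" and p: "p permutes {..<n}"
  shows "(\<integral>\<^sup>+x. f (\<lambda>i\<in>{..<n}. x (p i)) \<partial>vol n) = (\<integral>\<^sup>+x. f x \<partial>vol n)"
proof -
  let ?T = "\<lambda>x. \<lambda>i\<in>{..<n}. x (p i)"
  have pin: "p i < n" if "i < n" for i using permutes_in_image[OF p, of i] that by auto
  have T[measurable]: "?T \<in> measurable (vol n) (vol n)"
    using pin by (intro measurable_restrict measurable_component_singleton) simp
  have "distr (vol n) (vol n) ?T = vol n"
  proof (rule lb.PiM_eqI)
    fix A :: "nat \<Rightarrow> real set" assume A: "\<And>i. i \<in> {..<n} \<Longrightarrow> A i \<in> sets lborel"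
    have inv: "inv p i < n" if "i < n" for i using permutes_in_image[OF permutes_inv[OF p], of i] that by auto
    have "emeasure (distr (vol n) (vol n) ?T) (Pi\<^sub>E {..<n} A) = emeasure (vol n) (?T -` Pi\<^sub>E {..<n} A \<inter> space (vol n))"
      using A by (intro emeasure_distr T sets_PiM_I_finite) auto
    also have "?T -` Pi\<^sub>E {..<n} A \<inter> space (vol n) = (\<Pi>\<^sub>E i\<in>{..<n}. A (inv p i))"
    proof (intro set_eqI iffI)
      fix x assume "x \<in> ?T -` Pi\<^sub>E {..<n} A \<inter> space (vol n)"
      then have x: "x \<in> extensional {..<n}" "\<And>i. i < n \<Longrightarrow> x (p i) \<in> A i" by (auto simp: space_PiM PiE_def Pi_def)
      show "x \<in> (\<Pi>\<^sub>E i\<in>{..<n}. A (inv p i))"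
        using x(1) x(2)[OF inv] by (auto simp: PiE_def Pi_def permutes_inverses[OF p])
    next
      fix x assume "x \<in> (\<Pi>\<^sub>E i\<in>{..<n}. A (inv p i))"
      then have x: "x \<in> extensional {..<n}" "\<And>i. i < n \<Longrightarrow> x i \<in> A (inv p i)" by (auto simp: PiE_def Pi_def)
      have "x (p i) \<in> A i" if "i < n" for i using x(2)[OF pin[OF that]] by (simp add: permutes_inverses[OF p])
      then show "x \<in> ?T -` Pi\<^sub>E {..<n} A \<inter> space (vol n)" using x(1) by (auto simp: space_PiM PiE_def Pi_def)
    qed
    also have "emeasure (vol n) \<dots> = (\<Prod>i<n. emeasure lborel (A (inv p i)))"
      using A inv by (subst lb.emeasure_PiM) auto
    also have "\<dots> = (\<Prod>i<n. emeasure lborel (A i))"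
      using prod.permute[OF permutes_inv[OF p], of "\<lambda>i. emeasure lborel (A i)"] by (simp add: comp_def)
    finally show "emeasure (distr (vol n) (vol n) ?T) (Pi\<^sub>E {..<n} A) = (\<Prod>i<n. emeasure lborel (A i))" .
  qed auto
  then have "(\<integral>\<^sup>+x. f x \<partial>vol n) = (\<integral>\<^sup>+x. f x \<partial>distr (vol n) (vol n) ?T)" by simp
  also have "\<dots> = (\<integral>\<^sup>+x. f (?T x) \<partial>vol n)" by (subst nn_integral_distr) auto
  finally show ?thesis ..
qed

section \<open>The second moment of the chord length\<close>

lemma measurable_line_point[measurable]:
  assumes f: "f \<in> measurable M (vol n)" and g: "g \<in> measurable M (vol n)" and h: "h \<in> borel_measurable M"
  shows "(\<lambda>w. line_point n (f w) (g w) (h w)) \<in> measurable M (vol n)"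
  unfolding line_point_def
proof (rule measurable_restrict)
  fix i assume i: "i \<in> {..<n}"
  have [measurable]: "(\<lambda>w. f w i) \<in> borel_measurable M" "(\<lambda>w. g w i) \<in> borel_measurable M"
    using measurable_compose[OF f measurable_component_singleton[OF i]]
      measurable_compose[OF g measurable_component_singleton[OF i]] by simp_all
  note h[measurable]
  show "(\<lambda>w. f w i + h w * g w i) \<in> measurable M lborel" by simp
qed

definition chord_length :: "nat \<Rightarrow> (nat \<Rightarrow> real) set \<Rightarrow> (nat \<Rightarrow> real) \<Rightarrow> (nat \<Rightarrow> real) \<Rightarrow> ennreal" where
  "chord_length n K x \<theta> = (\<integral>\<^sup>+s. indicator K (line_point n x \<theta> s) \<partial>lborel)"

lemma measurable_chord_length[measurable]:
  assumes [measurable]: "f \<in> measurable M (vol n)" "g \<in> measurable M (vol n)" "K \<in> sets (vol n)"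
  shows "(\<lambda>w. chord_length n K (f w) (g w)) \<in> borel_measurable M"
  unfolding chord_length_def by measurable

text \<open>Removing from \<open>S\<close> the interval of length \<open>l / 2\<close> centred at \<open>-d\<close> leaves measure at least \<open>l / 2\<close>,
and there \<open>(s + d)\<^sup>2\<close> is at least \<open>l\<^sup>2 / 16\<close>.\<close>

lemma cube_le_second_moment:
  assumes [measurable]: "S \<in> sets borel" and l: "emeasure lborel S = ennreal l" "l \<ge> 0"
  shows "ennreal (l ^ 3) \<le> 32 * (\<integral>\<^sup>+s. ennreal ((s + d)\<^sup>2) * indicator S s \<partial>lborel)"
proof -
  let ?J = "{- d - l / 4..- d + l / 4}"
  have "ennreal l \<le> emeasure lborel ((S - ?J) \<union> ?J)"
    unfolding l(1)[symmetric] by (rule emeasure_mono) auto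
  also have "\<dots> \<le> emeasure lborel (S - ?J) + emeasure lborel ?J"
    by (rule emeasure_subadditive) auto
  also have "emeasure lborel ?J = ennreal (l / 2)" using l by simp
  finally have "ennreal l - ennreal (l / 2) \<le> emeasure lborel (S - ?J)"
    by (simp add: ennreal_minus_le_iff add.commute)
  then have half: "ennreal (l / 2) \<le> emeasure lborel (S - ?J)"
    using l by (simp add: ennreal_minus)
  have "ennreal (l ^ 3) = 32 * (ennreal (l\<^sup>2 / 16) * ennreal (l / 2))"
    using l by (simp add: power2_eq_square power3_eq_cube flip: ennreal_mult ennreal_numeral)
  also have "\<dots> \<le> 32 * (ennreal (l\<^sup>2 / 16) * emeasure lborel (S - ?J))"
    by (intro mult_left_mono half) auto
  also have "ennreal (l\<^sup>2 / 16) * emeasure lborel (S - ?J) = (\<integral>\<^sup>+s. ennreal (l\<^sup>2 / 16) * indicator (S - ?J) s \<partial>lborel)"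
    by (simp add: nn_integral_cmult)
  also have "\<dots> \<le> (\<integral>\<^sup>+s. ennreal ((s + d)\<^sup>2) * indicator S s \<partial>lborel)"
  proof (rule nn_integral_mono)
    fix s
    show "ennreal (l\<^sup>2 / 16) * indicator (S - ?J) s \<le> ennreal ((s + d)\<^sup>2) * indicator S s"
    proof (cases "s \<in> S - ?J")
      case True
      then have "s < - d - l / 4 \<or> s > - d + l / 4" by auto
      then have "l / 4 \<le> \<bar>s + d\<bar>" by linarith
      then have "(l / 4)\<^sup>2 \<le> \<bar>s + d\<bar>\<^sup>2" using l by (intro power_mono) auto
      then show ?thesis using True by (simp add: power_divide ennreal_leI)
    qed auto
  qed
  finally show ?thesis by (simp add: mult_left_mono)
qed

lemma line_point_add: "line_point n (line_point n x \<theta> s) \<theta> t = line_point n x \<theta> (s + t)"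
  by (auto simp: line_point_def fun_eq_iff algebra_simps)

lemma line_point_0: "x \<in> extensional {..<n} \<Longrightarrow> line_point n x \<theta> 0 = x"
  by (auto simp: line_point_def fun_eq_iff extensional_def)

lemma chord_length_line_point: 
  assumes [measurable]: "K \<in> sets (vol n)" "x \<in> space (vol n)" "\<theta> \<in> space (vol n)"
  shows "chord_length n K (line_point n x \<theta> s) \<theta> = chord_length n K x \<theta>"
  unfolding chord_length_def line_point_add
  by (subst (2) nn_integral_real_affine[where c = 1 and t = s]) auto

lemma chord_length_finite:
  assumes [measurable]: "K \<in> sets (vol n)" "x \<in> space (vol n)" "\<theta> \<in> space (vol n)"
    and B: "\<And>x i. x \<in> K \<Longrightarrow> i < n \<Longrightarrow> \<bar>x i\<bar> \<le> B" and i: "i < n" "\<theta> i \<noteq> 0"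
  shows "chord_length n K x \<theta> < \<infinity>"
proof -
  define r where "r = (\<bar>B\<bar> + \<bar>x i\<bar>) / \<bar>\<theta> i\<bar>"
  have "chord_length n K x \<theta> \<le> (\<integral>\<^sup>+s. indicator {-r..r} s \<partial>lborel)"
    unfolding chord_length_def
  proof (rule nn_integral_mono)
    fix s show "(indicator K (line_point n x \<theta> s) :: ennreal) \<le> indicator {-r..r} s"
    proof (cases "line_point n x \<theta> s \<in> K")
      case True
      then have "\<bar>x i + s * \<theta> i\<bar> \<le> B" using B[OF True i(1)] i by (simp add: line_point_def)
      then have "\<bar>s\<bar> * \<bar>\<theta> i\<bar> \<le> \<bar>B\<bar> + \<bar>x i\<bar>" by (simp flip: abs_mult)
      then have "\<bar>s\<bar> \<le> r" using i by (simp add: r_def field_simps)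
      then show ?thesis by (auto simp: indicator_def)
    qed auto
  qed
  also have "\<dots> < \<infinity>" by (simp add: emeasure_lborel_Icc_eq)
  finally show ?thesis .
qed

text \<open>The squared length is bounded by the mean over the chord of the squared linear form, because along
a unit vector that form is \<open>s + d\<close> at parameter \<open>s\<close>. The mean is written with \<open>inverse\<close>, so that a chord of length \<open>0\<close>
gives \<open>0\<close> on both sides: the product of \<open>\<infinity>\<close> and \<open>0\<close> is \<open>0\<close>.\<close>

lemma chord_length_sq_le:
  assumes [measurable]: "K \<in> sets (vol n)" "x \<in> space (vol n)" "\<theta> \<in> space (vol n)"
    and fin: "chord_length n K x \<theta> < \<infinity>"
    and norm: "(\<Sum>i<n. (\<theta> i)\<^sup>2) = 1"
  shows "(chord_length n K x \<theta>)\<^sup>2 \<le> 32 * (inverse (chord_length n K x \<theta>) *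
    (\<integral>\<^sup>+s. ennreal ((\<Sum>i<n. \<theta> i * (line_point n x \<theta> s i - c i))\<^sup>2) * indicator K (line_point n x \<theta> s) \<partial>lborel))"
proof -
  define S where "S = {s. line_point n x \<theta> s \<in> K}"
  have [measurable]: "S \<in> sets borel" unfolding S_def by measurable
  define l where "l = enn2real (chord_length n K x \<theta>)"
  have l: "chord_length n K x \<theta> = ennreal l" "l \<ge> 0" using fin by (simp_all add: l_def)
  have ind: "indicator K (line_point n x \<theta> s) = (indicator S s :: ennreal)" for s by (simp add: S_def indicator_def)
  have S: "emeasure lborel S = ennreal l"
    unfolding l(1)[symmetric] chord_length_def ind by simp
  define d where "d = (\<Sum>i<n. \<theta> i * (x i - c i))"
  have lin: "(\<Sum>i<n. \<theta> i * (line_point n x \<theta> s i - c i)) = s + d" for s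
  proof -
    have "(\<Sum>i<n. \<theta> i * (line_point n x \<theta> s i - c i)) = (\<Sum>i<n. s * (\<theta> i)\<^sup>2 + \<theta> i * (x i - c i))"
      by (intro sum.cong) (auto simp: line_point_def algebra_simps power2_eq_square)
    then show ?thesis by (simp add: sum.distrib d_def norm flip: sum_distrib_left)
  qed
  show ?thesis
  proof (cases "l = 0")
    case True then show ?thesis using l by simp
  next
    case False
    then have "l > 0" using l by simp
    have "ennreal (l\<^sup>2) = inverse (ennreal l) * ennreal (l ^ 3)"
      using \<open>l > 0\<close> by (simp add: inverse_ennreal power2_eq_square power3_eq_cube flip: ennreal_mult)
    also have "\<dots> \<le> inverse (ennreal l) * (32 * (\<integral>\<^sup>+s. ennreal ((s + d)\<^sup>2) * indicator S s \<partial>lborel))"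
      using l S by (intro mult_left_mono cube_le_second_moment) auto
    finally show ?thesis using l by (simp add: ind lin ennreal_power mult.left_commute)
  qed
qed

text \<open>Averaging over the chord through a uniform point of \<open>K\<close> leaves the integral over \<open>K\<close> unchanged (or
decreases it, because of chords of length \<open>0\<close>). To see this without coordinates adapted
to \<open>\<theta>\<close>, exchange the integrals over the point \<open>x\<close> and the parameter \<open>s\<close> and substitute \<open>y = x + s \<theta>\<close>: the
chord through \<open>y\<close> is the chord through \<open>x\<close>, so the weights \<open>1 / l\<close> add up over it to at most 1.\<close>

lemma chord_second_moment:
  assumes [measurable]: "K \<in> sets (vol n)" and B: "\<And>x i. x \<in> K \<Longrightarrow> i < n \<Longrightarrow> \<bar>x i\<bar> \<le> B"
    and \<theta>[measurable]: "\<theta> \<in> space (vol n)" and norm: "(\<Sum>i<n. (\<theta> i)\<^sup>2) = 1"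
  shows "(\<integral>\<^sup>+x. (chord_length n K x \<theta>)\<^sup>2 * indicator K x \<partial>vol n)
    \<le> 32 * (\<integral>\<^sup>+x. ennreal ((\<Sum>i<n. \<theta> i * (x i - c i))\<^sup>2) * indicator K x \<partial>vol n)"
proof -
  interpret pair_sigma_finite "vol n" "lborel :: real measure" by standard
  define w where "w x = inverse (chord_length n K x \<theta>)" for x
  define g where "g y = ennreal ((\<Sum>i<n. \<theta> i * (y i - c i))\<^sup>2) * indicator K y" for y :: "nat \<Rightarrow> real"
  have [measurable]: "w \<in> borel_measurable (vol n)" "g \<in> borel_measurable (vol n)"
    unfolding w_def[abs_def] g_def[abs_def] by measurable
  have "\<exists>i<n. \<theta> i \<noteq> 0" using norm by (metis (no_types, lifting) lessThan_iff sum.neutral power_zero_numeral zero_neq_one)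
  then obtain i where i: "i < n" "\<theta> i \<noteq> 0" by blast
  have fin: "chord_length n K x \<theta> < \<infinity>" if "x \<in> space (vol n)" for x
    by (rule chord_length_finite[where B = B and i = i]) (use that i B \<theta> in auto)
  have "(\<integral>\<^sup>+x. (chord_length n K x \<theta>)\<^sup>2 * indicator K x \<partial>vol n)
    \<le> (\<integral>\<^sup>+x. 32 * (w x * (\<integral>\<^sup>+s. g (line_point n x \<theta> s) \<partial>lborel)) * indicator K x \<partial>vol n)"
    unfolding w_def g_def by (intro nn_integral_mono mult_right_mono chord_length_sq_le fin norm assms) auto
  also have "\<dots> = 32 * (\<integral>\<^sup>+x. w x * indicator K x * (\<integral>\<^sup>+s. g (line_point n x \<theta> s) \<partial>lborel) \<partial>vol n)"
    by (subst nn_integral_cmult[symmetric]) (auto intro!: nn_integral_cong simp: ac_simps)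
  also have "(\<integral>\<^sup>+x. w x * indicator K x * (\<integral>\<^sup>+s. g (line_point n x \<theta> s) \<partial>lborel) \<partial>vol n)
    = (\<integral>\<^sup>+x. (\<integral>\<^sup>+s. w x * indicator K x * g (line_point n x \<theta> s) \<partial>lborel) \<partial>vol n)"
    by (intro nn_integral_cong, subst nn_integral_cmult) auto
  also have "\<dots> = (\<integral>\<^sup>+s. (\<integral>\<^sup>+x. w x * indicator K x * g (line_point n x \<theta> s) \<partial>vol n) \<partial>lborel)"
    by (subst Fubini'[where f = "\<lambda>x s. w x * indicator K x * g (line_point n x \<theta> s)"]) auto
  also have "\<dots> = (\<integral>\<^sup>+s. (\<integral>\<^sup>+y. w y * indicator K (line_point n y \<theta> (- s)) * g y \<partial>vol n) \<partial>lborel)"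
  proof (rule nn_integral_cong)
    fix s
    have "(\<integral>\<^sup>+x. w x * indicator K x * g (line_point n x \<theta> s) \<partial>vol n)
        = (\<integral>\<^sup>+x. (\<lambda>y. w y * indicator K (line_point n y \<theta> (- s)) * g y) (\<lambda>i\<in>{..<n}. s * \<theta> i + 1 * x i) \<partial>vol n)"
    proof (rule nn_integral_cong)
      fix x assume x: "x \<in> space (vol n)"
      have eq: "(\<lambda>i\<in>{..<n}. s * \<theta> i + 1 * x i) = line_point n x \<theta> s" by (auto simp: line_point_def)
      have "line_point n x \<theta> 0 = x" using x by (intro line_point_0) (auto simp: space_PiM PiE_def)
      then show "w x * indicator K x * g (line_point n x \<theta> s) =
         (\<lambda>y. w y * indicator K (line_point n y \<theta> (- s)) * g y) (\<lambda>i\<in>{..<n}. s * \<theta> i + 1 * x i)"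
        unfolding eq w_def using chord_length_line_point[OF assms(1) x \<theta>] by (simp add: line_point_add)
    qed
    also have "\<dots> = (\<integral>\<^sup>+y. w y * indicator K (line_point n y \<theta> (- s)) * g y \<partial>vol n)"
      by (rule nn_integral_vol_affine) auto
    finally show "(\<integral>\<^sup>+x. w x * indicator K x * g (line_point n x \<theta> s) \<partial>vol n)
      = (\<integral>\<^sup>+y. w y * indicator K (line_point n y \<theta> (- s)) * g y \<partial>vol n)" .
  qed
  also have "\<dots> = (\<integral>\<^sup>+y. (\<integral>\<^sup>+s. w y * indicator K (line_point n y \<theta> (- s)) * g y \<partial>lborel) \<partial>vol n)"
    by (subst Fubini'[where f = "\<lambda>y s. w y * indicator K (line_point n y \<theta> (- s)) * g y"]) auto
  also have "\<dots> \<le> (\<integral>\<^sup>+y. g y \<partial>vol n)"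
  proof (rule nn_integral_mono)
    fix y assume [measurable]: "y \<in> space (vol n)"
    have "(\<integral>\<^sup>+s. w y * indicator K (line_point n y \<theta> (- s)) * g y \<partial>lborel)
        = w y * g y * (\<integral>\<^sup>+s. indicator K (line_point n y \<theta> (- s)) \<partial>lborel)"
      by (subst nn_integral_cmult[symmetric]) (auto intro!: nn_integral_cong simp: ac_simps)
    also have "(\<integral>\<^sup>+s. indicator K (line_point n y \<theta> (- s)) \<partial>lborel) = chord_length n K y \<theta>"
      unfolding chord_length_def
      by (subst (2) nn_integral_real_affine[where c = "-1" and t = 0]) auto
    also have "w y * g y * chord_length n K y \<theta> = (inverse (chord_length n K y \<theta>) * chord_length n K y \<theta>) * g y"
      by (simp add: w_def ac_simps)
    also have "\<dots> \<le> 1 * g y"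
    proof (rule mult_right_mono)
      show "inverse (chord_length n K y \<theta>) * chord_length n K y \<theta> \<le> 1"
      proof (cases "chord_length n K y \<theta>")
        case (real r)
        then show ?thesis
          by (cases "r = 0") (simp_all add: inverse_ennreal flip: ennreal_mult)
      qed (use fin[of y] in simp)
    qed auto
    finally show "(\<integral>\<^sup>+s. w y * indicator K (line_point n y \<theta> (- s)) * g y \<partial>lborel) \<le> g y" by simp
  qed
  finally show ?thesis by (simp add: g_def mult_left_mono)
qed

section \<open>Second moments on the sphere\<close>

lemma measurable_L2_set[measurable]: "(\<lambda>x. L2_set x {..<n}) \<in> borel_measurable (vol n)"
  unfolding L2_set_def by measurable

lemma unit_ball_measurable[measurable]: "unit_ball n \<in> sets (vol n)"
proof -
  have "{x \<in> space (vol n). L2_set x {..<n} \<le> 1} \<in> sets (vol n)" by measurable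
  then show ?thesis by (simp add: unit_ball_def space_PiM)
qed

lemma emeasure_unit_ball_pos: "emeasure (vol n) (unit_ball n) > 0"
proof -
  let ?A = "\<Pi>\<^sub>E i\<in>{..<n}. {0..1 / real n}"
  have "0 < (\<Prod>i<n. ennreal (1 / real n))"
    by (cases "n = 0") (auto simp: ennreal_power)
  also have "\<dots> = emeasure (vol n) ?A"
    by (subst lb.emeasure_PiM) auto
  also have "\<dots> \<le> emeasure (vol n) (unit_ball n)"
  proof (rule emeasure_mono)
    show "?A \<subseteq> unit_ball n"
    proof
      fix x assume x: "x \<in> ?A"
      have "L2_set x {..<n} \<le> (\<Sum>i<n. \<bar>x i\<bar>)" by (rule L2_set_le_sum_abs)
      also have "\<dots> \<le> (\<Sum>i<n. 1 / real n)"
        using PiE_mem[OF x] by (intro sum_mono) auto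
      also have "\<dots> \<le> 1" by simp
      finally show "x \<in> unit_ball n" using x by (auto simp: unit_ball_def PiE_def)
    qed
  qed simp
  finally show ?thesis .
qed

lemma emeasure_unit_ball_finite: "emeasure (vol n) (unit_ball n) < \<infinity>"
proof -
  have "emeasure (vol n) (unit_ball n) \<le> emeasure (vol n) (\<Pi>\<^sub>E i\<in>{..<n}. {-1..1})"
  proof (rule emeasure_mono)
    show "unit_ball n \<subseteq> (\<Pi>\<^sub>E i\<in>{..<n}. {-1..1})"
    proof
      fix x assume x: "x \<in> unit_ball n"
      have "\<bar>x i\<bar> \<le> 1" if "i < n" for i
      proof -
        have "x i ^ 2 \<le> (\<Sum>i<n. (x i)\<^sup>2)" using that by (intro member_le_sum) auto
        also have "\<dots> \<le> 1" using x by (simp add: unit_ball_def L2_set_def)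
        finally show ?thesis by (simp add: abs_square_le_1)
      qed
      then show "x \<in> (\<Pi>\<^sub>E i\<in>{..<n}. {-1..1})" using x by (auto simp: unit_ball_def PiE_def abs_le_iff)
    qed
    show "(\<Pi>\<^sub>E i\<in>{..<n}. {-1..1}) \<in> sets (vol n)" by (intro sets_PiM_I_finite) auto
  qed
  also have "\<dots> = (\<Prod>i<n. ennreal 2)" by (subst lb.emeasure_PiM) auto
  also have "\<dots> < \<infinity>" by (simp add: ennreal_power less_top[symmetric] power_eq_top_ennreal)
  finally show ?thesis .
qed

definition radial_projection :: "nat \<Rightarrow> (nat \<Rightarrow> real) \<Rightarrow> nat \<Rightarrow> real" where
  "radial_projection n y = (\<lambda>i\<in>{..<n}. y i / L2_set y {..<n})"

lemma radial_projection_measurable[measurable]: "radial_projection n \<in> measurable (vol n) (vol n)"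
  unfolding radial_projection_def[abs_def] by (rule measurable_restrict) simp

lemma sets_uniform_sphere[measurable_cong, simp]: "sets (uniform_sphere n) = sets (vol n)"
  by (simp add: uniform_sphere_def)

lemma space_uniform_sphere[simp]: "space (uniform_sphere n) = space (vol n)"
  by (simp add: uniform_sphere_def)

lemma prob_space_uniform_sphere: "prob_space (uniform_sphere n)"
  unfolding uniform_sphere_def radial_projection_def[symmetric]
proof (rule prob_space.prob_space_distr)
  show "prob_space (uniform_measure (vol n) (unit_ball n))"
    using emeasure_unit_ball_pos[of n] emeasure_unit_ball_finite[of n]
    by (intro prob_space_uniform_measure) auto
  show "radial_projection n \<in> measurable (uniform_measure (vol n) (unit_ball n)) (vol n)"
    by simp
qed

lemma nn_integral_uniform_sphere:
  assumes [measurable]: "f \<in> borel_measurable (vol n)"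
  shows "(\<integral>\<^sup>+\<theta>. f \<theta> \<partial>uniform_sphere n)
    = (\<integral>\<^sup>+y. f (radial_projection n y) * indicator (unit_ball n) y \<partial>vol n) / emeasure (vol n) (unit_ball n)"
  unfolding uniform_sphere_def radial_projection_def[symmetric]
  by (subst nn_integral_distr) (auto simp: nn_integral_uniform_measure)

lemma uniform_sphere_signs:
  assumes [measurable]: "f \<in> borel_measurable (vol n)" and e: "\<And>i. i < n \<Longrightarrow> \<bar>e i\<bar> = 1"
  shows "(\<integral>\<^sup>+\<theta>. f (\<lambda>i\<in>{..<n}. e i * \<theta> i) \<partial>uniform_sphere n) = (\<integral>\<^sup>+\<theta>. f \<theta> \<partial>uniform_sphere n)"
proof -
  let ?T = "\<lambda>y. \<lambda>i\<in>{..<n}. 0 + e i * y i"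
  have "(e i)\<^sup>2 = 1" if "i < n" for i using e[OF that] by (simp add: abs_square_eq_1)
  then have L2: "L2_set (?T y) {..<n} = L2_set y {..<n}" for y
    unfolding L2_set_def by (intro arg_cong[of _ _ sqrt] sum.cong) (auto simp: power_mult_distrib)
  have "(\<integral>\<^sup>+y. f (\<lambda>i\<in>{..<n}. e i * radial_projection n y i) * indicator (unit_ball n) y \<partial>vol n)
     = (\<integral>\<^sup>+y. (\<lambda>y. f (radial_projection n y) * indicator (unit_ball n) y) (?T y) \<partial>vol n)"
  proof (rule nn_integral_cong)
    fix y assume "y \<in> space (vol n)"
    then have "(?T y \<in> unit_ball n) = (y \<in> unit_ball n)" unfolding unit_ball_def using L2[of y] by (simp add: space_PiM)
    moreover have "(\<lambda>i\<in>{..<n}. e i * radial_projection n y i) = radial_projection n (?T y)"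
      unfolding radial_projection_def L2 by (auto simp: fun_eq_iff)
    ultimately show "f (\<lambda>i\<in>{..<n}. e i * radial_projection n y i) * indicator (unit_ball n) y
        = (\<lambda>y. f (radial_projection n y) * indicator (unit_ball n) y) (?T y)"
      by (simp add: indicator_def)
  qed
  also have "\<dots> = (\<integral>\<^sup>+y. f (radial_projection n y) * indicator (unit_ball n) y \<partial>vol n)"
    by (rule nn_integral_vol_affine) (use e in auto)
  finally show ?thesis
    by (subst (1 2) nn_integral_uniform_sphere) simp_all
qed

lemma uniform_sphere_permute:
  assumes [measurable]: "f \<in> borel_measurable (vol n)" and p: "p permutes {..<n}"
  shows "(\<integral>\<^sup>+\<theta>. f (\<lambda>i\<in>{..<n}. \<theta> (p i)) \<partial>uniform_sphere n) = (\<integral>\<^sup>+\<theta>. f \<theta> \<partial>uniform_sphere n)"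
proof -
  let ?T = "\<lambda>y :: nat \<Rightarrow> real. \<lambda>i\<in>{..<n}. y (p i)"
  have pin: "p i < n" if "i < n" for i using permutes_in_image[OF p, of i] that by auto
  have [measurable]: "?T \<in> measurable (vol n) (vol n)"
    using pin by (intro measurable_restrict measurable_component_singleton) simp
  have L2: "L2_set (?T y) {..<n} = L2_set y {..<n}" for y
    unfolding L2_set_def using sum.permute[OF p, of "\<lambda>i. (y i)\<^sup>2"] by (simp add: comp_def)
  have "(\<integral>\<^sup>+y. f (?T (radial_projection n y)) * indicator (unit_ball n) y \<partial>vol n)
     = (\<integral>\<^sup>+y. (\<lambda>y. f (radial_projection n y) * indicator (unit_ball n) y) (?T y) \<partial>vol n)"
  proof (rule nn_integral_cong)
    fix y assume "y \<in> space (vol n)"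
    then have "(?T y \<in> unit_ball n) = (y \<in> unit_ball n)" unfolding unit_ball_def using L2[of y] by (simp add: space_PiM)
    moreover have "?T (radial_projection n y) = radial_projection n (?T y)"
      unfolding radial_projection_def L2 using pin by (auto simp: fun_eq_iff)
    ultimately show "f (?T (radial_projection n y)) * indicator (unit_ball n) y
        = (\<lambda>y. f (radial_projection n y) * indicator (unit_ball n) y) (?T y)"
      by (simp add: indicator_def)
  qed
  also have "\<dots> = (\<integral>\<^sup>+y. f (radial_projection n y) * indicator (unit_ball n) y \<partial>vol n)"
    by (rule nn_integral_vol_permute[OF _ p]) auto
  finally show ?thesis
    by (subst (1 2) nn_integral_uniform_sphere) simp_all
qed

text \<open>The second alternative is the image of the centre of the ball.\<close>

lemma uniform_sphere_norm:
  "AE \<theta> in uniform_sphere n. (\<Sum>i<n. (\<theta> i)\<^sup>2) = 1 \<or> (\<forall>i<n. \<theta> i = 0)"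
proof -
  have *: "(\<Sum>i<n. (radial_projection n y i)\<^sup>2) = 1 \<or> (\<forall>i<n. radial_projection n y i = 0)" for y
  proof (cases "L2_set y {..<n} = 0")
    case True then show ?thesis by (simp add: radial_projection_def)
  next
    case False
    have "(\<Sum>i<n. (radial_projection n y i)\<^sup>2) = (\<Sum>i<n. (y i)\<^sup>2) / (L2_set y {..<n})\<^sup>2"
      by (simp add: radial_projection_def power_divide sum_divide_distrib)
    also have "\<dots> = 1" using False by (simp add: L2_set_def sum_nonneg)
    finally show ?thesis ..
  qed
  have "{\<theta> \<in> space (vol n). (\<Sum>i<n. (\<theta> i)\<^sup>2) = 1 \<or> (\<forall>i\<in>{..<n}. \<theta> i = 0)} \<in> sets (vol n)" by measurable
  then show ?thesis
    unfolding uniform_sphere_def radial_projection_def[symmetric]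
    by (subst AE_distr_iff) (auto simp: *)
qed

text \<open>The coordinates are exchangeable and their squares add up to at most 1.\<close>

lemma uniform_sphere_coordinate_sq:
  assumes j: "j < n"
  shows "(\<integral>\<^sup>+\<theta>. ennreal ((\<theta> j)\<^sup>2) \<partial>uniform_sphere n) \<le> ennreal (1 / real n)"
proof -
  interpret prob_space "uniform_sphere n" by (rule prob_space_uniform_sphere)
  let ?a = "\<lambda>i. \<integral>\<^sup>+\<theta>. ennreal ((\<theta> i)\<^sup>2) \<partial>uniform_sphere n"
  have [measurable]: "(\<lambda>\<theta>. \<theta> i) \<in> borel_measurable (vol n)" if "i < n" for i
    using measurable_component_singleton[of i "{..<n}" "\<lambda>_. lborel"] that by simp
  have eq: "?a i = ?a j" if i: "i < n" for i
  proof -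
    have "Transposition.transpose i j permutes {..<n}" using i j by (intro permutes_swap_id) auto
    from uniform_sphere_permute[OF _ this, of "\<lambda>\<theta>. ennreal ((\<theta> j)\<^sup>2)"] show ?thesis using i j by simp
  qed
  have "of_nat n * ?a j = (\<Sum>i<n. ?a i)" using eq by simp
  also have "\<dots> = (\<integral>\<^sup>+\<theta>. (\<Sum>i<n. ennreal ((\<theta> i)\<^sup>2)) \<partial>uniform_sphere n)"
    by (rule nn_integral_sum[symmetric]) auto
  also have "\<dots> \<le> (\<integral>\<^sup>+\<theta>. 1 \<partial>uniform_sphere n)"
  proof (rule nn_integral_mono_AE, use uniform_sphere_norm[of n] in eventually_elim)
    fix \<theta> :: "nat \<Rightarrow> real" assume "(\<Sum>i<n. (\<theta> i)\<^sup>2) = 1 \<or> (\<forall>i<n. \<theta> i = 0)"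
    then show "(\<Sum>i<n. ennreal ((\<theta> i)\<^sup>2)) \<le> 1" by (subst sum_ennreal) auto
  qed
  also have "\<dots> = 1" by (simp add: emeasure_space_1[simplified])
  finally have le: "of_nat n * ?a j \<le> 1" .
  have "?a j = (of_nat n * ?a j) / of_nat n"
    using j by (intro ennreal_mult_divide_eq[symmetric, of "of_nat n" "?a j", simplified mult.commute]) auto
  also have "\<dots> \<le> 1 / of_nat n" using le by (rule divide_right_mono_ennreal)
  also have "\<dots> = ennreal (1 / real n)"
    using j by (simp add: ennreal_of_nat_eq_real_of_nat divide_ennreal flip: ennreal_1)
  finally show ?thesis .
qed

text \<open>The mixed moments vanish because reflections preserve the law. With the reflection of the coordinate \<open>j\<close> this takes the form
of the parallelogram law: \<open>(A + \<theta>\<^sub>j z\<^sub>j)\<^sup>2\<close> and \<open>(A - \<theta>\<^sub>j z\<^sub>j)\<^sup>2\<close> have the same mean, and they add up to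
\<open>2 * A\<^sup>2 + 2 * (\<theta>\<^sub>j z\<^sub>j)\<^sup>2\<close>. Hence the terms can be split off one at a time.\<close>

lemma uniform_sphere_linear_sq:
  "(\<integral>\<^sup>+\<theta>. ennreal ((\<Sum>i<n. \<theta> i * z i)\<^sup>2) \<partial>uniform_sphere n) \<le> ennreal ((\<Sum>i<n. (z i)\<^sup>2) / real n)"
proof -
  have m[measurable]: "(\<lambda>\<theta>. \<theta> i) \<in> borel_measurable (vol n)" if "i < n" for i
    using measurable_component_singleton[of i "{..<n}" "\<lambda>_. lborel"] that by simp
  have "(\<integral>\<^sup>+\<theta>. ennreal ((\<Sum>i\<in>J. \<theta> i * z i)\<^sup>2) \<partial>uniform_sphere n) \<le> ennreal ((\<Sum>i\<in>J. (z i)\<^sup>2) / real n)"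
    if "finite J" "J \<subseteq> {..<n}" for J
    using that
  proof (induction J rule: finite_induct)
    case empty then show ?case by simp
  next
    case (insert j J)
    then have j: "j < n" and J: "J \<subseteq> {..<n}" by auto
    define A where "A \<theta> = (\<Sum>i\<in>J. \<theta> i * z i)" for \<theta> :: "nat \<Rightarrow> real"
    have [measurable]: "A \<in> borel_measurable (vol n)"
      unfolding A_def[abs_def] using J by (intro borel_measurable_sum borel_measurable_times m) auto
    note [measurable] = m[OF j]
    let ?f = "\<lambda>\<theta>. ennreal ((A \<theta> + \<theta> j * z j)\<^sup>2)"
    define e where "e i = (if i = j then -1 else 1 :: real)" for i
    have "(\<integral>\<^sup>+\<theta>. ?f \<theta> \<partial>uniform_sphere n) = (\<integral>\<^sup>+\<theta>. ?f (\<lambda>i\<in>{..<n}. e i * \<theta> i) \<partial>uniform_sphere n)"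
      by (rule uniform_sphere_signs[symmetric]) (auto simp: e_def)
    also have "\<dots> = (\<integral>\<^sup>+\<theta>. ennreal ((A \<theta> - \<theta> j * z j)\<^sup>2) \<partial>uniform_sphere n)"
    proof (rule nn_integral_cong)
      fix \<theta> :: "nat \<Rightarrow> real"
      have "A (\<lambda>i\<in>{..<n}. e i * \<theta> i) = A \<theta>"
        unfolding A_def using J insert.hyps by (intro sum.cong) (auto simp: e_def)
      then show "?f (\<lambda>i\<in>{..<n}. e i * \<theta> i) = ennreal ((A \<theta> - \<theta> j * z j)\<^sup>2)" using j by (simp add: e_def)
    qed
    finally have flip: "(\<integral>\<^sup>+\<theta>. ?f \<theta> \<partial>uniform_sphere n) = (\<integral>\<^sup>+\<theta>. ennreal ((A \<theta> - \<theta> j * z j)\<^sup>2) \<partial>uniform_sphere n)" .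
    have "2 * (\<integral>\<^sup>+\<theta>. ?f \<theta> \<partial>uniform_sphere n)
        = (\<integral>\<^sup>+\<theta>. ?f \<theta> \<partial>uniform_sphere n) + (\<integral>\<^sup>+\<theta>. ennreal ((A \<theta> - \<theta> j * z j)\<^sup>2) \<partial>uniform_sphere n)"
      unfolding mult_2 by (subst (2) flip) simp
    also have "\<dots> = (\<integral>\<^sup>+\<theta>. ?f \<theta> + ennreal ((A \<theta> - \<theta> j * z j)\<^sup>2) \<partial>uniform_sphere n)"
      by (rule nn_integral_add[symmetric]) auto
    also have "\<dots> = (\<integral>\<^sup>+\<theta>. 2 * (ennreal ((A \<theta>)\<^sup>2) + ennreal ((z j)\<^sup>2) * ennreal ((\<theta> j)\<^sup>2)) \<partial>uniform_sphere n)"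
    proof (rule nn_integral_cong)
      fix \<theta> :: "nat \<Rightarrow> real"
      have "(A \<theta> + \<theta> j * z j)\<^sup>2 + (A \<theta> - \<theta> j * z j)\<^sup>2 = 2 * ((A \<theta>)\<^sup>2 + (z j)\<^sup>2 * (\<theta> j)\<^sup>2)"
        by (simp add: power2_eq_square algebra_simps)
      then have "ennreal ((A \<theta> + \<theta> j * z j)\<^sup>2 + (A \<theta> - \<theta> j * z j)\<^sup>2) = ennreal (2 * ((A \<theta>)\<^sup>2 + (z j)\<^sup>2 * (\<theta> j)\<^sup>2))"
        by simp
      then show "?f \<theta> + ennreal ((A \<theta> - \<theta> j * z j)\<^sup>2) = 2 * (ennreal ((A \<theta>)\<^sup>2) + ennreal ((z j)\<^sup>2) * ennreal ((\<theta> j)\<^sup>2))"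
        by (simp add: ennreal_mult ennreal_plus del: ennreal_plus_if)
    qed
    also have "\<dots> = 2 * ((\<integral>\<^sup>+\<theta>. ennreal ((A \<theta>)\<^sup>2) \<partial>uniform_sphere n)
        + ennreal ((z j)\<^sup>2) * (\<integral>\<^sup>+\<theta>. ennreal ((\<theta> j)\<^sup>2) \<partial>uniform_sphere n))"
      by (simp add: nn_integral_cmult nn_integral_add)
    also have "\<dots> \<le> 2 * (ennreal ((\<Sum>i\<in>J. (z i)\<^sup>2) / real n) + ennreal ((z j)\<^sup>2) * ennreal (1 / real n))"
      using insert.IH[OF J] j unfolding A_def
      by (intro mult_left_mono add_mono uniform_sphere_coordinate_sq) auto
    also have "\<dots> = 2 * ennreal ((\<Sum>i\<in>insert j J. (z i)\<^sup>2) / real n)"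
      using insert.hyps by (simp add: sum_nonneg add_divide_distrib add.commute flip: ennreal_mult ennreal_plus)
    finally have "(\<integral>\<^sup>+\<theta>. ?f \<theta> \<partial>uniform_sphere n) \<le> ennreal ((\<Sum>i\<in>insert j J. (z i)\<^sup>2) / real n)"
      by (subst (asm) ennreal_mult_le_mult_iff) auto
    moreover have "(\<Sum>i\<in>insert j J. \<theta> i * z i) = A \<theta> + \<theta> j * z j" for \<theta>
      using insert.hyps by (simp add: A_def add.commute)
    ultimately show ?case by simp
  qed
  from this[of "{..<n}"] show ?thesis by simp
qed

section \<open>A pair of quantiles at distance one half\<close>

text \<open>The quantile function \<open>I\<close> maps the uniform law on \<open>(0, 1)\<close> to \<open>M\<close>. So the sum of \<open>g (I q)\<close> and
\<open>g (I (q + 1/2))\<close> has integral at most \<open>D\<close> over \<open>q\<close> in \<open>(0, 1/2)\<close>, hence its mean there is at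
most \<open>2 * D\<close> and it cannot exceed \<open>3 * D\<close> throughout.\<close>

lemma (in real_distribution) halving_quantiles:
  fixes g :: "real \<Rightarrow> ennreal"
  assumes atomless: "\<And>x. prob {x} = 0"
    and [measurable]: "g \<in> borel_measurable borel"
    and D: "(\<integral>\<^sup>+x. g x \<partial>M) \<le> ennreal D" "D > 0"
  shows "\<exists>a b. prob {a<..b} = 1 / 2 \<and> g a + g b \<le> ennreal (3 * D)"
proof -
  interpret cdf_distribution M by standard
  have C_I: "C (I w) = w" if "0 < w" "w < 1" for w
  proof (rule antisym)
    show "w \<le> C (I w)" using pseudoinverse[OF that, of "I w"] by simp
    have "isCont C (I w)" using isCont_cdf atomless by simp
    then have "(C \<longlongrightarrow> C (I w)) (at_left (I w))"
      by (simp add: isCont_def filterlim_at_split)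
    moreover have "\<forall>\<^sub>F x in at_left (I w). C x \<le> w"
    proof (rule eventually_at_leftI[of "I w - 1"])
      fix x assume "x \<in> {I w - 1<..<I w}"
      then have "\<not> w \<le> C x" using pseudoinverse[OF that, of x] by simp
      then show "C x \<le> w" by simp
    qed simp
    ultimately show "C (I w) \<le> w" by (rule tendsto_upperbound) simp
  qed
  have "\<exists>q. 0 < q \<and> q < 1/2 \<and> g (I q) + g (I (q + 1/2)) \<le> ennreal (3 * D)"
  proof (rule ccontr)
    assume "\<not> ?thesis"
    then have big: "ennreal (3 * D) \<le> g (I q) + g (I (q + 1/2))" if "0 < q" "q < 1/2" for q
      using that by (meson not_le order.strict_implies_order)
    \<comment> \<open>\<open>I\<close> is measurable only on \<open>(0, 1)\<close>; extending by \<open>0\<close> gives a function to integrate over the line.\<close>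
    define k where "k w = (if w \<in> {0<..<1} then g (I w) else 0)" for w
    have gI: "(\<lambda>w. g (I w)) \<in> borel_measurable (restrict_space borel {0<..<1})"
      by (rule measurable_compose[OF measurable_CI]) simp
    then have [measurable]: "k \<in> borel_measurable borel"
      unfolding k_def by (subst measurable_If_restrict_space_iff) (simp_all del: greaterThanLessThan_iff)
    have "ennreal (3 * D / 2) = (\<integral>\<^sup>+q. ennreal (3 * D) * indicator {0<..<1/2::real} q \<partial>lborel)"
    proof -
      have "(\<integral>\<^sup>+q. ennreal (3 * D) * indicator {0<..<1/2::real} q \<partial>lborel) = ennreal (3 * D) * ennreal (1/2)"
        by (subst nn_integral_cmult_indicator) auto
      also have "\<dots> = ennreal (3 * D * (1/2))"
        using D by (intro ennreal_mult[symmetric]) auto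
      finally show ?thesis by simp
    qed
    also have "\<dots> \<le> (\<integral>\<^sup>+q. k q * indicator {0<..<1/2} q + k (1/2 + 1 * q) * indicator {1/2<..<1} (1/2 + 1 * q) \<partial>lborel)"
      using big by (intro nn_integral_mono) (auto simp: indicator_def k_def add.commute)
    also have "\<dots> = (\<integral>\<^sup>+q. k q * indicator {0<..<1/2} q \<partial>lborel) + (\<integral>\<^sup>+q. k (1/2 + 1 * q) * indicator {1/2<..<1} (1/2 + 1 * q) \<partial>lborel)"
      by (intro nn_integral_add) auto
    also have "(\<integral>\<^sup>+q. k (1/2 + 1 * q) * indicator {1/2<..<1} (1/2 + 1 * q) \<partial>lborel) = (\<integral>\<^sup>+q. k q * indicator {1/2<..<1} q \<partial>lborel)"
      by (subst (2) nn_integral_real_affine[where c = 1 and t = "1/2"]) auto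
    also have "(\<integral>\<^sup>+q. k q * indicator {0<..<1/2} q \<partial>lborel) + (\<integral>\<^sup>+q. k q * indicator {1/2<..<1} q \<partial>lborel)
        = (\<integral>\<^sup>+q. k q * indicator {0<..<1/2} q + k q * indicator {1/2<..<1} q \<partial>lborel)"
      by (intro nn_integral_add[symmetric]) auto
    also have "\<dots> \<le> (\<integral>\<^sup>+q. g (I q) * indicator {0<..<1} q \<partial>lborel)"
      by (intro nn_integral_mono) (auto simp: indicator_def k_def)
    also have "\<dots> = (\<integral>\<^sup>+q. g (I q) \<partial>restrict_space lborel {0<..<1})"
      by (subst nn_integral_restrict_space) auto
    also have "\<dots> = (\<integral>\<^sup>+x. g x \<partial>distr (restrict_space lborel {0<..<1::real}) borel I)"
      by (subst nn_integral_distr) auto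
    also have "\<dots> = (\<integral>\<^sup>+x. g x \<partial>M)" by (simp only: distr_I_eq_M)
    also have "\<dots> \<le> ennreal D" by (rule D)
    finally show False using D by (simp add: ennreal_le_iff)
  qed
  then obtain q where q: "0 < q" "q < 1/2" "g (I q) + g (I (q + 1/2)) \<le> ennreal (3 * D)" by blast
  have "I q < I (q + 1/2)"
  proof (rule ccontr)
    assume "\<not> I q < I (q + 1/2)"
    then have "C (I (q + 1/2)) \<le> C (I q)" by (intro cdf_nondecreasing) simp
    then show False using q C_I by simp
  qed
  then have "prob {I q<..I (q + 1/2)} = 1/2" using q C_I cdf_diff_eq[of "I q" "I (q + 1/2)"] by simp
  with q show ?thesis by blast
qed

lemma ennreal_young:
  fixes l :: ennreal assumes "k > 0" "t \<ge> 0"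
  shows "2 * (l * ennreal t) \<le> ennreal (1 / k) * l\<^sup>2 + ennreal k * ennreal (t\<^sup>2)"
proof (cases l)
  case (real r)
  have "0 \<le> (r - k * t)\<^sup>2 / k" using assms by simp
  also have "\<dots> = 1 / k * r\<^sup>2 + k * t\<^sup>2 - 2 * (r * t)" using assms by (simp add: field_simps power2_eq_square)
  finally have "ennreal (2 * (r * t)) \<le> ennreal (1 / k * r\<^sup>2 + k * t\<^sup>2)" by (intro ennreal_leI) simp
  also have "\<dots> = ennreal (1 / k * r\<^sup>2) + ennreal (k * t\<^sup>2)"
    using assms by (intro ennreal_plus) auto
  also have "ennreal (1 / k * r\<^sup>2) = ennreal (1 / k) * (ennreal r)\<^sup>2"
    using real assms by (subst ennreal_mult) (auto simp: ennreal_power)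
  also have "ennreal (k * t\<^sup>2) = ennreal k * ennreal (t\<^sup>2)"
    using assms by (intro ennreal_mult) auto
  also have "ennreal (2 * (r * t)) = 2 * (l * ennreal t)"
    using real assms by (simp add: ennreal_mult)
  finally show ?thesis using real by simp
next
  case top
  then show ?thesis using assms by (simp add: power2_eq_square ennreal_mult_top)
qed

section \<open>A uniform point of a convex body\<close>

locale uniform_in_body =
  fixes n :: nat and K :: "(nat \<Rightarrow> real) set"
  assumes body: "convex_body n K"
begin

abbreviation uni :: "(nat \<Rightarrow> real) measure" where "uni \<equiv> uniform_measure (vol n) K"

definition marginal :: "nat \<Rightarrow> real measure" where "marginal i = distr uni borel (\<lambda>x. x i)"

lemma K_sets[measurable]: "K \<in> sets (vol n)" by (rule convex_body_measurable[OF body])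

lemma K_convex_combination: "x \<in> K \<Longrightarrow> y \<in> K \<Longrightarrow> u \<ge> 0 \<Longrightarrow> v \<ge> 0 \<Longrightarrow> u + v = 1 \<Longrightarrow> (\<lambda>i\<in>{..<n}. u * x i + v * y i) \<in> K"
  using body unfolding convex_body_def by blast

definition radius where "radius = (SOME B. B \<ge> 0 \<and> (\<forall>x\<in>K. \<forall>i<n. \<bar>x i\<bar> \<le> B))"

lemma radius: "radius \<ge> 0" "\<And>x i. x \<in> K \<Longrightarrow> i < n \<Longrightarrow> \<bar>x i\<bar> \<le> radius"
  using someI_ex[OF convex_body_bounded[OF body]] unfolding radius_def by blast+

lemma vol_K: "emeasure (vol n) K > 0" "emeasure (vol n) K < \<infinity>"
proof -
  show "emeasure (vol n) K > 0" by (rule convex_body_positive[OF body])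
  have "emeasure (vol n) K \<le> emeasure (vol n) (\<Pi>\<^sub>E i\<in>{..<n}. {-radius..radius})"
  proof (rule emeasure_mono)
    have "K \<subseteq> space (vol n)" by (rule sets.sets_into_space) (rule K_sets)
    then have "x \<in> (\<Pi>\<^sub>E i\<in>{..<n}. {-radius..radius})" if "x \<in> K" for x
      using that radius(2)[OF that] by (auto simp: space_PiM PiE_def abs_le_iff minus_le_iff)
    then show "K \<subseteq> (\<Pi>\<^sub>E i\<in>{..<n}. {-radius..radius})" by (rule subsetI)
    show "(\<Pi>\<^sub>E i\<in>{..<n}. {-radius..radius}) \<in> sets (vol n)" by (intro sets_PiM_I_finite) auto
  qed
  also have "\<dots> = (\<Prod>i<n. ennreal (2 * radius))" using radius(1) by (subst lb.emeasure_PiM) auto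
  also have "\<dots> < \<infinity>" by (simp add: less_top[symmetric] power_eq_top_ennreal)
  finally show "emeasure (vol n) K < \<infinity>" .
qed

sublocale uni: prob_space uni
  using vol_K by (intro prob_space_uniform_measure) auto

lemma coord[measurable]: "i < n \<Longrightarrow> (\<lambda>x. x i) \<in> borel_measurable (vol n)"
  using measurable_component_singleton[of i "{..<n}" "\<lambda>_. lborel"] by simp

lemma real_distribution_marginal: "i < n \<Longrightarrow> real_distribution (marginal i)"
  unfolding marginal_def by (intro real_distribution.intro uni.prob_space_distr real_distribution_axioms.intro) auto

lemma AE_uni: "AE x in uni. x \<in> K"
  by (rule AE_uniform_measureI) auto

lemma emeasure_marginal:
  assumes "i < n" "S \<in> sets borel"
  shows "emeasure (marginal i) S = emeasure (vol n) {x \<in> K. x i \<in> S} / emeasure (vol n) K"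
proof -
  note [measurable] = assms(2) coord[OF assms(1)]
  have "emeasure (marginal i) S = emeasure uni ((\<lambda>x. x i) -` S \<inter> space uni)"
    unfolding marginal_def by (rule emeasure_distr) auto
  also have "\<dots> = emeasure (vol n) (K \<inter> ((\<lambda>x. x i) -` S \<inter> space (vol n))) / emeasure (vol n) K"
    by (subst emeasure_uniform_measure) auto
  also have "K \<inter> ((\<lambda>x. x i) -` S \<inter> space (vol n)) = {x \<in> K. x i \<in> S}"
    using sets.sets_into_space[OF K_sets] by auto
  finally show ?thesis .
qed

lemma slab_measurable[measurable]:
  assumes "i < n" "S \<in> sets borel"
  shows "{x \<in> K. x i \<in> S} \<in> sets (vol n)"
proof -
  note [measurable] = assms(2) coord[OF assms(1)]
  have "{x \<in> K. x i \<in> S} = K \<inter> {x \<in> space (vol n). x i \<in> S}"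
    using sets.sets_into_space[OF K_sets] by auto
  also have "\<dots> \<in> sets (vol n)" by measurable
  finally show ?thesis .
qed

text \<open>By convexity the midpoint of a point in the slab over one interval and a point in the slab over a
translate lies in the slab over the interval halfway between them. Apply the Prekopa-Leindler inequality
to the indicators of the three slabs.\<close>

lemma marginal_log_concave:
  assumes i: "i < n" shows "midpoint_log_concave (marginal i)"
  unfolding midpoint_log_concave_def
proof (intro allI impI)
  fix s t w :: real assume "w > 0"
  interpret nu: real_distribution "marginal i" by (rule real_distribution_marginal[OF i])
  define T where "T r = {x \<in> K. x i \<in> {r..<r + w}}" for r
  have [measurable]: "T r \<in> sets (vol n)" for r unfolding T_def using i by (intro slab_measurable) auto
  have "(\<integral>\<^sup>+x. indicator (T s) x \<partial>vol n) * (\<integral>\<^sup>+x. indicator (T t) x \<partial>vol n) \<le> (\<integral>\<^sup>+x. indicator (T ((s + t) / 2)) x \<partial>vol n)\<^sup>2"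
  proof (rule prekopa_leindler)
    fix x y :: "nat \<Rightarrow> real"
    have "(\<lambda>i\<in>{..<n}. (x i + y i) / 2) = (\<lambda>i\<in>{..<n}. 1/2 * x i + 1/2 * y i)" by auto
    then have "(\<lambda>i\<in>{..<n}. (x i + y i) / 2) \<in> T ((s + t) / 2)" if "x \<in> T s" "y \<in> T t"
      using that K_convex_combination[of x y "1/2" "1/2"] i by (auto simp: T_def field_simps)
    then show "(indicator (T s) x :: ennreal) * indicator (T t) y \<le> (indicator (T ((s + t) / 2)) (\<lambda>i\<in>{..<n}. (x i + y i) / 2))\<^sup>2"
      by (auto simp: indicator_def)
  qed auto
  then have "emeasure (vol n) (T s) * emeasure (vol n) (T t) \<le> (emeasure (vol n) (T ((s + t) / 2)))\<^sup>2" by simp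
  then have "emeasure (vol n) (T s) * emeasure (vol n) (T t) * (inverse (emeasure (vol n) K))\<^sup>2
     \<le> (emeasure (vol n) (T ((s + t) / 2)))\<^sup>2 * (inverse (emeasure (vol n) K))\<^sup>2"
    by (rule mult_right_mono) simp
  then have "emeasure (marginal i) {s..<s + w} * emeasure (marginal i) {t..<t + w}
     \<le> (emeasure (marginal i) {(s + t) / 2..<(s + t) / 2 + w})\<^sup>2"
    using i by (simp add: emeasure_marginal T_def divide_ennreal_def power2_eq_square ac_simps)
  then show "nu.prob {s..<s + w} * nu.prob {t..<t + w} \<le> (nu.prob {(s + t) / 2..<(s + t) / 2 + w})\<^sup>2"
    by (simp add: nu.emeasure_eq_measure ennreal_power flip: ennreal_mult)
qed

definition center :: "nat \<Rightarrow> real" where "center i = uni.expectation (\<lambda>x. x i)"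

definition var :: "nat \<Rightarrow> real" where "var i = uni.expectation (\<lambda>x. (x i - center i)\<^sup>2)"

lemma integrable_coord:
  assumes i: "i < n"
  shows "integrable uni (\<lambda>x. x i)" "integrable uni (\<lambda>x. (x i - c)\<^sup>2)"
proof -
  note [measurable] = coord[OF i]
  show "integrable uni (\<lambda>x. x i)"
    using AE_uni radius(2)[OF _ i] by (intro uni.integrable_const_bound[of _ radius]) auto
  show "integrable uni (\<lambda>x. (x i - c)\<^sup>2)"
  proof (rule uni.integrable_const_bound[of _ "(radius + \<bar>c\<bar>)\<^sup>2"])
    show "AE x in uni. norm ((x i - c)\<^sup>2) \<le> (radius + \<bar>c\<bar>)\<^sup>2"
      using AE_uni
    proof eventually_elim
      case (elim x)
      then have "\<bar>x i - c\<bar> \<le> radius + \<bar>c\<bar>" using radius(2)[OF elim i] by linarith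
      then show ?case using power_mono[of "\<bar>x i - c\<bar>" "radius + \<bar>c\<bar>" 2] by simp
    qed
  qed auto
qed

text \<open>The variance is the least second moment about any point.\<close>

lemma var_le:
  assumes i: "i < n"
  shows "ennreal (var i) \<le> (\<integral>\<^sup>+x. ennreal ((x - c)\<^sup>2) \<partial>marginal i)"
proof -
  note [measurable] = coord[OF i]
  have "var i \<le> var i + (center i - c)\<^sup>2" by simp
  also have "\<dots> = uni.expectation (\<lambda>x. (x i - center i)\<^sup>2 + (2 * (center i - c) * (x i - center i) + (center i - c)\<^sup>2))"
    using integrable_coord[OF i] uni.prob_space by (simp add: var_def center_def)
  also have "\<dots> = uni.expectation (\<lambda>x. (x i - c)\<^sup>2)"
    by (intro Bochner_Integration.integral_cong) (auto simp: power2_eq_square algebra_simps)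
  finally have "ennreal (var i) \<le> ennreal (uni.expectation (\<lambda>x. (x i - c)\<^sup>2))" by (rule ennreal_leI)
  also have "\<dots> = (\<integral>\<^sup>+x. ennreal ((x i - c)\<^sup>2) \<partial>uni)"
    using integrable_coord[OF i] by (intro nn_integral_eq_integral[symmetric]) auto
  also have "\<dots> = (\<integral>\<^sup>+x. ennreal ((x - c)\<^sup>2) \<partial>marginal i)"
    unfolding marginal_def by (subst nn_integral_distr) auto
  finally show ?thesis .
qed

text \<open>A vanishing variance would put \<open>X\<close> almost surely in a hyperplane, which is a null set.\<close>

lemma var_pos:
  assumes i: "i < n" shows "var i > 0"
proof (rule ccontr)
  note [measurable] = coord[OF i]
  assume "\<not> var i > 0"
  moreover have "var i \<ge> 0" unfolding var_def by simp
  ultimately have "var i = 0" by linarith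
  then have "uni.expectation (\<lambda>x. (x i - center i)\<^sup>2) = 0" by (simp add: var_def)
  then have "AE x in uni. (x i - center i)\<^sup>2 = 0"
    using integrable_coord[OF i] by (subst (asm) integral_nonneg_eq_0_iff_AE) auto
  moreover have "AE x in uni. x i \<noteq> center i"
  proof (rule AE_uniform_measureI)
    have "AE x in vol n. x i \<noteq> center i"
      by (rule AE_I[OF _ emeasure_hyperplane[OF i, of "center i"]]) auto
    then show "AE x in vol n. x \<in> K \<longrightarrow> x i \<noteq> center i" by eventually_elim simp
  qed simp
  ultimately have "AE x in uni. False" by eventually_elim simp
  then show False by simp
qed

lemma marginal_interval:
  assumes i: "i < n" and ab: "a \<le> b"
  shows "measure (marginal i) {a..b} \<le> 136 * (b - a) / sqrt (var i)"
proof -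
  interpret nu: real_distribution "marginal i" by (rule real_distribution_marginal[OF i])
  note [measurable] = coord[OF i]
  show ?thesis
  proof (rule nu.midpoint_log_concave_interval_bound)
    show "AE x in marginal i. \<bar>x\<bar> \<le> radius"
      unfolding marginal_def using AE_uni radius(2)[OF _ i] by (subst AE_distr_iff) auto
  qed (use i ab var_pos var_le marginal_log_concave in auto)
qed

end

section \<open>Chords that cross a coordinate hyperplane\<close>

context uniform_in_body
begin

interpretation sphere: prob_space "uniform_sphere n" by (rule prob_space_uniform_sphere)

interpretation pair: pair_prob_space uni "uniform_sphere n" by standard

lemma chord_sq_uni:
  assumes \<theta>: "\<theta> \<in> space (vol n)" and norm: "(\<Sum>i<n. (\<theta> i)\<^sup>2) = 1"
  shows "(\<integral>\<^sup>+x. (chord_length n K x \<theta>)\<^sup>2 \<partial>uni)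
    \<le> 32 * (\<integral>\<^sup>+x. ennreal ((\<Sum>i<n. \<theta> i * (x i - center i))\<^sup>2) \<partial>uni)"
proof -
  note [measurable] = \<theta>
  have "(\<integral>\<^sup>+x. (chord_length n K x \<theta>)\<^sup>2 \<partial>uni)
     = (\<integral>\<^sup>+x. (chord_length n K x \<theta>)\<^sup>2 * indicator K x \<partial>vol n) / emeasure (vol n) K"
    by (rule nn_integral_uniform_measure) measurable
  also have "\<dots> \<le> 32 * (\<integral>\<^sup>+x. ennreal ((\<Sum>i<n. \<theta> i * (x i - center i))\<^sup>2) * indicator K x \<partial>vol n) / emeasure (vol n) K"
    by (intro divide_right_mono_ennreal chord_second_moment[where B = radius] K_sets \<theta> norm radius(2))
  also have "\<dots> = 32 * (\<integral>\<^sup>+x. ennreal ((\<Sum>i<n. \<theta> i * (x i - center i))\<^sup>2) \<partial>uni)"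
    by (subst nn_integral_uniform_measure) (auto simp: ennreal_times_divide)
  finally show ?thesis .
qed

lemma linear_sq_average:
  assumes V: "\<And>j. j < n \<Longrightarrow> var j \<le> V" and n: "n > 0"
  shows "(\<integral>\<^sup>+\<theta>. (\<integral>\<^sup>+x. ennreal ((\<Sum>i<n. \<theta> i * (x i - center i))\<^sup>2) \<partial>uni) \<partial>uniform_sphere n) \<le> ennreal V"
proof -
  have "(\<integral>\<^sup>+\<theta>. (\<integral>\<^sup>+x. ennreal ((\<Sum>i<n. \<theta> i * (x i - center i))\<^sup>2) \<partial>uni) \<partial>uniform_sphere n)
     = (\<integral>\<^sup>+x. (\<integral>\<^sup>+\<theta>. ennreal ((\<Sum>i<n. \<theta> i * (x i - center i))\<^sup>2) \<partial>uniform_sphere n) \<partial>uni)"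
    by (rule pair.Fubini') measurable
  also have "\<dots> \<le> (\<integral>\<^sup>+x. ennreal ((\<Sum>i<n. (x i - center i)\<^sup>2) / real n) \<partial>uni)"
    by (intro nn_integral_mono uniform_sphere_linear_sq)
  also have "\<dots> = ennreal (uni.expectation (\<lambda>x. (\<Sum>i<n. (x i - center i)\<^sup>2) / real n))"
    by (intro nn_integral_eq_integral integrable_divide Bochner_Integration.integrable_sum integrable_coord)
       (auto intro!: sum_nonneg divide_nonneg_nonneg AE_I2)
  also have "uni.expectation (\<lambda>x. (\<Sum>i<n. (x i - center i)\<^sup>2) / real n) = (\<Sum>i<n. var i) / real n"
    unfolding var_def by (simp add: Bochner_Integration.integral_sum integrable_coord)
  also have "ennreal ((\<Sum>i<n. var i) / real n) \<le> ennreal V"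
    using sum_bounded_above[of "{..<n}" var V] V n by (intro ennreal_leI) (simp add: field_simps)
  finally show ?thesis .
qed

text \<open>Young's inequality \<open>2 l |\<theta>\<^sub>i| \<le> l\<^sup>2 / k + k \<theta>\<^sub>i\<^sup>2\<close> separates the length from the direction. The means of
\<open>l\<^sup>2\<close> and \<open>\<theta>\<^sub>i\<^sup>2\<close> are bounded by \<open>32 \<sigma>\<^sup>2\<close> and \<open>1 / n\<close> with \<open>\<sigma>\<^sup>2 = var i\<close>, and \<open>k = \<sigma> sqrt n\<close> balances them
up to a constant.\<close>

lemma expected_projected_chord:
  assumes i: "i < n" and V: "\<And>j. j < n \<Longrightarrow> var j \<le> var i"
  shows "(\<integral>\<^sup>+\<theta>. (\<integral>\<^sup>+x. chord_length n K x \<theta> * ennreal \<bar>\<theta> i\<bar> \<partial>uni) \<partial>uniform_sphere n)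
    \<le> ennreal (17 * sqrt (var i) / sqrt (real n))"
proof -
  note [measurable] = coord[OF i]
  have n: "n > 0" using i by simp
  define k where "k = sqrt (var i) * sqrt (real n)"
  have k: "k > 0" using var_pos[OF i] n by (simp add: k_def)
  define Q where "Q \<theta> = (\<integral>\<^sup>+x. ennreal ((\<Sum>i<n. \<theta> i * (x i - center i))\<^sup>2) \<partial>uni)" for \<theta>
  have [measurable]: "Q \<in> borel_measurable (vol n)" unfolding Q_def[abs_def] by measurable
  have "2 * (\<integral>\<^sup>+\<theta>. (\<integral>\<^sup>+x. chord_length n K x \<theta> * ennreal \<bar>\<theta> i\<bar> \<partial>uni) \<partial>uniform_sphere n)
      = (\<integral>\<^sup>+\<theta>. 2 * (\<integral>\<^sup>+x. chord_length n K x \<theta> * ennreal \<bar>\<theta> i\<bar> \<partial>uni) \<partial>uniform_sphere n)"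
    by (rule nn_integral_cmult[symmetric]) measurable
  also have "\<dots> \<le> (\<integral>\<^sup>+\<theta>. ennreal (1 / k) * (32 * Q \<theta>) + ennreal k * ennreal ((\<theta> i)\<^sup>2) \<partial>uniform_sphere n)"
  proof (rule nn_integral_mono_AE)
    have "AE \<theta> in uniform_sphere n. \<theta> \<in> space (vol n)" using AE_space[of "uniform_sphere n"] by simp
    with uniform_sphere_norm[of n]
    show "AE \<theta> in uniform_sphere n. 2 * (\<integral>\<^sup>+x. chord_length n K x \<theta> * ennreal \<bar>\<theta> i\<bar> \<partial>uni)
      \<le> ennreal (1 / k) * (32 * Q \<theta>) + ennreal k * ennreal ((\<theta> i)\<^sup>2)"
    proof eventually_elim
      case (elim \<theta>)
      note [measurable] = elim(2)
      show ?case
      \<comment> \<open>If \<open>\<theta>\<^sub>i = 0\<close> the left side is \<open>0\<close>, even when the chord is infinitely long because \<open>\<theta> = 0\<close>.\<close>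
      proof (cases "\<theta> i = 0")
        case False
        then have norm: "(\<Sum>i<n. (\<theta> i)\<^sup>2) = 1" using elim i by auto
        have "2 * (\<integral>\<^sup>+x. chord_length n K x \<theta> * ennreal \<bar>\<theta> i\<bar> \<partial>uni)
           = (\<integral>\<^sup>+x. 2 * (chord_length n K x \<theta> * ennreal \<bar>\<theta> i\<bar>) \<partial>uni)"
          by (rule nn_integral_cmult[symmetric]) measurable
        also have "\<dots> \<le> (\<integral>\<^sup>+x. ennreal (1 / k) * (chord_length n K x \<theta>)\<^sup>2 + ennreal k * ennreal ((\<theta> i)\<^sup>2) \<partial>uni)"
          using ennreal_young[OF k, of "\<bar>\<theta> i\<bar>"] by (intro nn_integral_mono) simp
        also have "\<dots> = (\<integral>\<^sup>+x. ennreal (1 / k) * (chord_length n K x \<theta>)\<^sup>2 \<partial>uni) + (\<integral>\<^sup>+x. ennreal k * ennreal ((\<theta> i)\<^sup>2) \<partial>uni)"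
          by (rule nn_integral_add) auto
        also have "\<dots> = ennreal (1 / k) * (\<integral>\<^sup>+x. (chord_length n K x \<theta>)\<^sup>2 \<partial>uni) + ennreal k * ennreal ((\<theta> i)\<^sup>2)"
          using uni.emeasure_space_1 by (simp add: nn_integral_cmult)
        also have "\<dots> \<le> ennreal (1 / k) * (32 * Q \<theta>) + ennreal k * ennreal ((\<theta> i)\<^sup>2)"
          unfolding Q_def by (intro add_right_mono mult_left_mono chord_sq_uni elim norm) auto
        finally show ?thesis .
      qed simp
    qed
  qed
  also have "\<dots> = (\<integral>\<^sup>+\<theta>. ennreal (1 / k) * (32 * Q \<theta>) \<partial>uniform_sphere n) + (\<integral>\<^sup>+\<theta>. ennreal k * ennreal ((\<theta> i)\<^sup>2) \<partial>uniform_sphere n)"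
    by (rule nn_integral_add) auto
  also have "\<dots> = ennreal (1 / k) * (32 * (\<integral>\<^sup>+\<theta>. Q \<theta> \<partial>uniform_sphere n)) + ennreal k * (\<integral>\<^sup>+\<theta>. ennreal ((\<theta> i)\<^sup>2) \<partial>uniform_sphere n)"
    by (simp add: nn_integral_cmult)
  also have "\<dots> \<le> ennreal (1 / k) * (32 * ennreal (var i)) + ennreal k * ennreal (1 / real n)"
    unfolding Q_def by (intro add_mono mult_left_mono linear_sq_average V n uniform_sphere_coordinate_sq i) auto
  also have "\<dots> = ennreal (33 * sqrt (var i) / sqrt (real n))"
  proof -
    have "ennreal (1 / k) * (32 * ennreal (var i)) + ennreal k * ennreal (1 / real n)
        = ennreal (1 / k) * ennreal (32 * var i) + ennreal k * ennreal (1 / real n)"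
      using var_pos[OF i] by (simp add: ennreal_mult)
    also have "\<dots> = ennreal (1 / k * (32 * var i)) + ennreal (k * (1 / real n))"
      using k var_pos[OF i] by (intro arg_cong2[of _ _ _ _ "(+)"] ennreal_mult[symmetric]) auto
    also have "\<dots> = ennreal (1 / k * (32 * var i) + k * (1 / real n))"
      using k var_pos[OF i] by (intro ennreal_plus[symmetric]) auto
    also have "1 / k * (32 * var i) + k * (1 / real n) = 33 * sqrt (var i) / sqrt (real n)"
    proof -
      define u where "u = sqrt (var i)"
      define v where "v = sqrt (real n)"
      have uv: "u > 0" "v > 0" "var i = u\<^sup>2" "real n = v\<^sup>2" using var_pos[OF i] n by (simp_all add: u_def v_def)
      show ?thesis unfolding k_def u_def[symmetric] v_def[symmetric] uv(3,4) using uv(1,2)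
        by (simp add: field_simps power2_eq_square)
    qed
    finally show ?thesis .
  qed
  also have "\<dots> \<le> ennreal (2 * (17 * sqrt (var i) / sqrt (real n)))"
    using var_pos[OF i] unfolding times_divide_eq_right
    by (intro ennreal_leI divide_right_mono) auto
  also have "\<dots> = 2 * ennreal (17 * sqrt (var i) / sqrt (real n))"
    using var_pos[OF i] by (subst ennreal_mult) auto
  finally show ?thesis
    by (subst (asm) ennreal_mult_le_mult_iff) auto
qed

text \<open>The line with direction \<open>\<theta>\<close> through \<open>x\<close> reaches the level \<open>x\<^sub>i = t\<close> at parameter \<open>(t - x\<^sub>i) / \<theta>\<^sub>i\<close>. A line
parallel to the hyperplane counts as not crossing it, since \<open>x\<^sub>i\<close> is constant along it.\<close>

definition crosses :: "nat \<Rightarrow> (nat \<Rightarrow> real) \<Rightarrow> (nat \<Rightarrow> real) \<Rightarrow> real \<Rightarrow> bool" where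
  "crosses i x \<theta> t \<longleftrightarrow> \<theta> i \<noteq> 0 \<and> line_point n x \<theta> ((t - x i) / \<theta> i) \<in> K"

lemma measurable_crosses[measurable]:
  assumes i: "i < n" and [measurable]: "f \<in> measurable M (vol n)" "g \<in> measurable M (vol n)" "h \<in> borel_measurable M"
  shows "Measurable.pred M (\<lambda>w. crosses i (f w) (g w) (h w))"
proof -
  have [measurable]: "(\<lambda>w. f w i) \<in> borel_measurable M" "(\<lambda>w. g w i) \<in> borel_measurable M"
    using measurable_compose[OF assms(2) coord[OF i]] measurable_compose[OF assms(3) coord[OF i]] by simp_all
  show ?thesis unfolding crosses_def by measurable
qed

lemma line_slice_convex:
  assumes "line_point n x \<theta> s \<in> K" "line_point n x \<theta> t \<in> K" "s \<le> r" "r \<le> t"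
  shows "line_point n x \<theta> r \<in> K"
proof (cases "s = t")
  case True then show ?thesis using assms by auto
next
  case False
  then have st: "s < t" using assms by simp
  define u where "u = (t - r) / (t - s)"
  define v where "v = (r - s) / (t - s)"
  have uv: "u \<ge> 0" "v \<ge> 0" "u + v = 1" using st assms by (auto simp: u_def v_def simp flip: add_divide_distrib)
  have "u * s + v * t = (r * (t - s)) / (t - s)"
    unfolding u_def v_def times_divide_eq_left add_divide_distrib[symmetric] by (simp add: algebra_simps)
  then have r: "u * s + v * t = r" using st by simp
  have "(\<lambda>i\<in>{..<n}. u * line_point n x \<theta> s i + v * line_point n x \<theta> t i) = line_point n x \<theta> r"
  proof
    fix i
    have "u * (x i + s * \<theta> i) + v * (x i + t * \<theta> i) = (u + v) * x i + (u * s + v * t) * \<theta> i"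
      by (simp add: algebra_simps)
    then show "(\<lambda>i\<in>{..<n}. u * line_point n x \<theta> s i + v * line_point n x \<theta> t i) i = line_point n x \<theta> r i"
      using uv(3) r by (simp add: line_point_def)
  qed
  then show ?thesis using K_convex_combination[OF assms(1,2) uv] by simp
qed

text \<open>The crossed levels correspond to parameters in an interval whose length is the chord length, so
any two of them differ by at most \<open>d = l |\<theta>\<^sub>i|\<close>, and all lie within distance \<open>d\<close> of a single one. This doubles
the constant 136 of the interval bound.\<close>

lemma crossed_levels_measure:
  assumes i: "i < n" and x: "x \<in> space (vol n)" and \<theta>: "\<theta> \<in> space (vol n)"
  shows "emeasure (marginal i) {t. crosses i x \<theta> t} \<le> ennreal (272 / sqrt (var i)) * (chord_length n K x \<theta> * ennreal \<bar>\<theta> i\<bar>)"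
proof (cases "\<exists>t0. crosses i x \<theta> t0")
  case False
  then have "{t. crosses i x \<theta> t} = {}" by auto
  then show ?thesis by simp
next
  case True
  then obtain t0 where t0: "crosses i x \<theta> t0" by blast
  then have \<theta>i: "\<theta> i \<noteq> 0" by (simp add: crosses_def)
  interpret nu: real_distribution "marginal i" by (rule real_distribution_marginal[OF i])
  note [measurable] = x \<theta>
  define l where "l = enn2real (chord_length n K x \<theta>)"
  have fin: "chord_length n K x \<theta> < \<infinity>"
    by (rule chord_length_finite[where B = radius and i = i]) (use x \<theta> i \<theta>i radius(2) in auto)
  then have l: "chord_length n K x \<theta> = ennreal l" "l \<ge> 0" by (simp_all add: l_def)
  have gap: "t - s \<le> l" if "line_point n x \<theta> s \<in> K" "line_point n x \<theta> t \<in> K" "s \<le> t" for s t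
  proof -
    have "ennreal (t - s) = (\<integral>\<^sup>+r. indicator {s..t} r \<partial>lborel)" using that by simp
    also have "\<dots> \<le> ennreal l"
      unfolding l(1)[symmetric] chord_length_def using line_slice_convex[OF that(1,2)]
      by (intro nn_integral_mono) (auto simp: indicator_def)
    finally show ?thesis using l by (simp add: ennreal_le_iff)
  qed
  define d where "d = l * \<bar>\<theta> i\<bar>"
  have "{t. crosses i x \<theta> t} \<subseteq> {t0 - d..t0 + d}"
  proof
    fix t assume "t \<in> {t. crosses i x \<theta> t}"
    then have t: "line_point n x \<theta> ((t - x i) / \<theta> i) \<in> K" by (simp add: crosses_def)
    have t0': "line_point n x \<theta> ((t0 - x i) / \<theta> i) \<in> K" using t0 by (simp add: crosses_def)
    have "\<bar>(t - x i) / \<theta> i - (t0 - x i) / \<theta> i\<bar> \<le> l"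
      using gap[OF t t0'] gap[OF t0' t] by linarith
    also have "(t - x i) / \<theta> i - (t0 - x i) / \<theta> i = (t - t0) / \<theta> i" by (simp flip: diff_divide_distrib)
    finally have "\<bar>t - t0\<bar> \<le> d" using \<theta>i by (simp add: d_def abs_divide field_simps)
    then show "t \<in> {t0 - d..t0 + d}" by auto
  qed
  then have "emeasure (marginal i) {t. crosses i x \<theta> t} \<le> emeasure (marginal i) {t0 - d..t0 + d}"
    by (rule emeasure_mono) simp
  also have "\<dots> \<le> ennreal (136 * ((t0 + d) - (t0 - d)) / sqrt (var i))"
    unfolding nu.emeasure_eq_measure using l by (intro ennreal_leI marginal_interval i) (simp add: d_def)
  also have "\<dots> = ennreal (272 / sqrt (var i) * (l * \<bar>\<theta> i\<bar>))" by (simp add: d_def)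
  also have "\<dots> = ennreal (272 / sqrt (var i)) * (chord_length n K x \<theta> * ennreal \<bar>\<theta> i\<bar>)"
  proof -
    have "ennreal (272 / sqrt (var i) * (l * \<bar>\<theta> i\<bar>)) = ennreal (272 / sqrt (var i)) * ennreal (l * \<bar>\<theta> i\<bar>)"
      using l(2) var_pos[OF i] by (intro ennreal_mult) auto
    then show ?thesis using l by (simp add: ennreal_mult)
  qed
  finally show ?thesis .
qed

definition crossing_prob :: "nat \<Rightarrow> real \<Rightarrow> ennreal" where
  "crossing_prob i t = emeasure (random_line n K) {(x, \<theta>) \<in> space (random_line n K). crosses i x \<theta> t}"

lemma space_random_line: "space (random_line n K) = space (vol n) \<times> space (vol n)"
  by (simp add: random_line_def space_pair_measure)

lemma sets_random_line[measurable_cong]: "sets (random_line n K) = sets (vol n \<Otimes>\<^sub>M vol n)"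
  unfolding random_line_def by (intro sets_pair_measure_cong) auto

lemma crossing_prob_nn_integral:
  assumes i: "i < n"
  shows "crossing_prob i t = (\<integral>\<^sup>+\<theta>. (\<integral>\<^sup>+x. indicator {t. crosses i x \<theta> t} t \<partial>uni) \<partial>uniform_sphere n)"
proof -
  have [measurable]: "(\<lambda>w. crosses i (fst w) (snd w) t) \<in> measurable (uni \<Otimes>\<^sub>M uniform_sphere n) (count_space UNIV)"
    by (rule measurable_crosses[OF i]) auto
  let ?A = "{(x, \<theta>) \<in> space (random_line n K). crosses i x \<theta> t}"
  have A: "?A = {w \<in> space (uni \<Otimes>\<^sub>M uniform_sphere n). crosses i (fst w) (snd w) t}"
    by (auto simp: random_line_def)
  have [measurable]: "?A \<in> sets (uni \<Otimes>\<^sub>M uniform_sphere n)" unfolding A by measurable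
  have "crossing_prob i t = emeasure (uni \<Otimes>\<^sub>M uniform_sphere n) ?A"
    by (simp add: crossing_prob_def random_line_def)
  also have "\<dots> = (\<integral>\<^sup>+w. indicator ?A w \<partial>(uni \<Otimes>\<^sub>M uniform_sphere n))"
    by (rule nn_integral_indicator[symmetric]) measurable
  also have "\<dots> = (\<integral>\<^sup>+\<theta>. (\<integral>\<^sup>+x. indicator ?A (x, \<theta>) \<partial>uni) \<partial>uniform_sphere n)"
    by (rule pair.nn_integral_snd[symmetric]) measurable
  also have "\<dots> = (\<integral>\<^sup>+\<theta>. (\<integral>\<^sup>+x. indicator {t. crosses i x \<theta> t} t \<partial>uni) \<partial>uniform_sphere n)"
    by (intro nn_integral_cong) (auto simp: indicator_def space_random_line)
  finally show ?thesis .
qed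

text \<open>By Fubini, this average is the mean over the random line of the mass that the law of \<open>X\<^sub>i\<close> gives to
the set of levels crossed by the line. The constant is \<open>4624 = 272 * 17\<close>.\<close>

lemma average_crossing_prob:
  assumes i: "i < n" and V: "\<And>j. j < n \<Longrightarrow> var j \<le> var i"
  shows "crossing_prob i \<in> borel_measurable borel"
    "(\<integral>\<^sup>+t. crossing_prob i t \<partial>marginal i) \<le> ennreal (4624 / sqrt (real n))"
proof -
  interpret nu: real_distribution "marginal i" by (rule real_distribution_marginal[OF i])
  interpret p1: pair_sigma_finite "uniform_sphere n" "marginal i" by standard
  interpret p2: pair_sigma_finite uni "marginal i" by standard
  let ?c = "\<lambda>x \<theta> t. indicator {t. crosses i x \<theta> t} t :: ennreal"
  have c3: "(\<lambda>w. ?c (f w) (g w) (h w)) \<in> borel_measurable M"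
    if "f \<in> measurable M (vol n)" "g \<in> measurable M (vol n)" "h \<in> borel_measurable M" for f g h M
  proof -
    have "Measurable.pred M (\<lambda>w. crosses i (f w) (g w) (h w))" by (rule measurable_crosses[OF i that])
    then have "(\<lambda>w. indicator {w. crosses i (f w) (g w) (h w)} w :: ennreal) \<in> borel_measurable M"
      by measurable
    then show ?thesis by (rule measurable_cong[THEN iffD1, rotated]) (auto simp: indicator_def)
  qed
  have c2: "(\<lambda>w. \<integral>\<^sup>+x. ?c x (g w) (h w) \<partial>uni) \<in> borel_measurable M"
    if [measurable]: "g \<in> measurable M (vol n)" "h \<in> borel_measurable M" for g h and M :: "'b measure"
  proof (rule uni.borel_measurable_nn_integral)
    show "(\<lambda>(w, x). ?c x (g w) (h w)) \<in> borel_measurable (M \<Otimes>\<^sub>M uni)"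
      unfolding case_prod_beta' by (rule c3) measurable
  qed
  show "crossing_prob i \<in> borel_measurable borel"
    unfolding crossing_prob_nn_integral[OF i, abs_def]
  proof (rule sphere.borel_measurable_nn_integral)
    show "(\<lambda>(t, \<theta>). \<integral>\<^sup>+x. ?c x \<theta> t \<partial>uni) \<in> borel_measurable (borel \<Otimes>\<^sub>M uniform_sphere n)"
      unfolding case_prod_beta' by (rule c2) measurable
  qed
  have "(\<integral>\<^sup>+t. crossing_prob i t \<partial>marginal i)
      = (\<integral>\<^sup>+t. (\<integral>\<^sup>+\<theta>. (\<integral>\<^sup>+x. ?c x \<theta> t \<partial>uni) \<partial>uniform_sphere n) \<partial>marginal i)"
    by (simp add: crossing_prob_nn_integral[OF i])
  also have "\<dots> = (\<integral>\<^sup>+\<theta>. (\<integral>\<^sup>+t. (\<integral>\<^sup>+x. ?c x \<theta> t \<partial>uni) \<partial>marginal i) \<partial>uniform_sphere n)"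
  proof (rule p1.Fubini')
    show "(\<lambda>(\<theta>, t). \<integral>\<^sup>+x. ?c x \<theta> t \<partial>uni) \<in> borel_measurable (uniform_sphere n \<Otimes>\<^sub>M marginal i)"
      unfolding case_prod_beta' by (rule c2) measurable
  qed
  also have "\<dots> = (\<integral>\<^sup>+\<theta>. (\<integral>\<^sup>+x. (\<integral>\<^sup>+t. ?c x \<theta> t \<partial>marginal i) \<partial>uni) \<partial>uniform_sphere n)"
  proof (rule nn_integral_cong)
    fix \<theta> assume "\<theta> \<in> space (uniform_sphere n)"
    then have [measurable]: "\<theta> \<in> space (vol n)" by simp
    show "(\<integral>\<^sup>+t. (\<integral>\<^sup>+x. ?c x \<theta> t \<partial>uni) \<partial>marginal i) = (\<integral>\<^sup>+x. (\<integral>\<^sup>+t. ?c x \<theta> t \<partial>marginal i) \<partial>uni)"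
    proof (rule p2.Fubini')
      show "(\<lambda>(x, t). ?c x \<theta> t) \<in> borel_measurable (uni \<Otimes>\<^sub>M marginal i)"
        unfolding case_prod_beta' by (rule c3) measurable
    qed
  qed
  also have "\<dots> \<le> (\<integral>\<^sup>+\<theta>. (\<integral>\<^sup>+x. ennreal (272 / sqrt (var i)) * (chord_length n K x \<theta> * ennreal \<bar>\<theta> i\<bar>) \<partial>uni) \<partial>uniform_sphere n)"
  proof (intro nn_integral_mono)
    fix x \<theta> assume x: "x \<in> space uni" and \<theta>: "\<theta> \<in> space (uniform_sphere n)"
    then have m: "x \<in> space (vol n)" "\<theta> \<in> space (vol n)" by simp_all
    have "Measurable.pred borel (\<lambda>t. crosses i x \<theta> t)"
      by (rule measurable_crosses[OF i]) (use m in auto)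
    then have "{t. crosses i x \<theta> t} \<in> sets (marginal i)" by (simp add: pred_def)
    then have "(\<integral>\<^sup>+t. ?c x \<theta> t \<partial>marginal i) = emeasure (marginal i) {t. crosses i x \<theta> t}" by (rule nn_integral_indicator)
    also have "\<dots> \<le> ennreal (272 / sqrt (var i)) * (chord_length n K x \<theta> * ennreal \<bar>\<theta> i\<bar>)"
      by (rule crossed_levels_measure[OF i m])
    finally show "(\<integral>\<^sup>+t. ?c x \<theta> t \<partial>marginal i) \<le> ennreal (272 / sqrt (var i)) * (chord_length n K x \<theta> * ennreal \<bar>\<theta> i\<bar>)" .
  qed
  also have "\<dots> = (\<integral>\<^sup>+\<theta>. ennreal (272 / sqrt (var i)) * (\<integral>\<^sup>+x. chord_length n K x \<theta> * ennreal \<bar>\<theta> i\<bar> \<partial>uni) \<partial>uniform_sphere n)"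
  proof (rule nn_integral_cong)
    fix \<theta> assume "\<theta> \<in> space (uniform_sphere n)"
    then have [measurable]: "\<theta> \<in> space (vol n)" by simp
    show "(\<integral>\<^sup>+x. ennreal (272 / sqrt (var i)) * (chord_length n K x \<theta> * ennreal \<bar>\<theta> i\<bar>) \<partial>uni)
        = ennreal (272 / sqrt (var i)) * (\<integral>\<^sup>+x. chord_length n K x \<theta> * ennreal \<bar>\<theta> i\<bar> \<partial>uni)"
      by (rule nn_integral_cmult) measurable
  qed
  also have "\<dots> = ennreal (272 / sqrt (var i)) * (\<integral>\<^sup>+\<theta>. (\<integral>\<^sup>+x. chord_length n K x \<theta> * ennreal \<bar>\<theta> i\<bar> \<partial>uni) \<partial>uniform_sphere n)"
  proof (rule nn_integral_cmult)
    note [measurable] = coord[OF i]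
    show "(\<lambda>\<theta>. \<integral>\<^sup>+x. chord_length n K x \<theta> * ennreal \<bar>\<theta> i\<bar> \<partial>uni) \<in> borel_measurable (uniform_sphere n)" by measurable
  qed
  also have "\<dots> \<le> ennreal (272 / sqrt (var i)) * ennreal (17 * sqrt (var i) / sqrt (real n))"
    by (intro mult_left_mono expected_projected_chord i V) auto
  also have "\<dots> = ennreal (272 / sqrt (var i) * (17 * sqrt (var i) / sqrt (real n)))"
    using var_pos[OF i] by (intro ennreal_mult[symmetric]) auto
  also have "\<dots> = ennreal (4624 / sqrt (real n))" using var_pos[OF i] by simp
  finally show "(\<integral>\<^sup>+t. crossing_prob i t \<partial>marginal i) \<le> ennreal (4624 / sqrt (real n))" .
qed

lemma line_length_eq:
  "line_length n x \<theta> (line n x \<theta> \<inter> S) = measure lborel {t. line_point n x \<theta> t \<in> S}"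
  by (auto simp: line_length_def line_def intro!: arg_cong[of _ _ "measure lborel"])

text \<open>If the chord contained both a point of \<open>A\<close> and a point of \<open>K\<close> outside \<open>A\<close>, then between
them it would cross the level \<open>a\<close> or the level \<open>b\<close>. So its parts in \<open>A\<close> and in \<open>K\<close> are equal or the former is
empty. A chord of length \<open>0\<close> has ratio \<open>0\<close> by the convention for division by zero.\<close>

lemma uncrossed_ratio:
  assumes i: "i < n" and "\<not> crosses i x \<theta> a" "\<not> crosses i x \<theta> b"
    and A: "A = {x \<in> K. x i \<in> {a<..b}}"
  shows "line_length n x \<theta> (line n x \<theta> \<inter> A) / line_length n x \<theta> (line n x \<theta> \<inter> K) \<in> {0, 1}"
proof -
  let ?p = "line_point n x \<theta>"
  have pi: "?p s i = x i + s * \<theta> i" for s using i by (simp add: line_point_def)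
  have level: False if "?p s \<in> K" "?p t \<in> K" "?p s i \<le> c" "c < ?p t i" "\<not> crosses i x \<theta> c" for s t c
  proof -
    have \<theta>i: "\<theta> i \<noteq> 0" using that(3,4) by (auto simp: pi)
    define r where "r = (c - x i) / \<theta> i"
    have c: "c = x i + r * \<theta> i" using \<theta>i by (simp add: r_def)
    have "(s \<le> r \<and> r \<le> t) \<or> (t \<le> r \<and> r \<le> s)"
    proof (cases "\<theta> i > 0")
      case True
      then have "s * \<theta> i \<le> r * \<theta> i" "r * \<theta> i \<le> t * \<theta> i" using that(3,4) unfolding c pi by auto
      then show ?thesis using True by simp
    next
      case False
      then have neg: "\<theta> i < 0" using \<theta>i by simp
      have "s * \<theta> i \<le> r * \<theta> i" "r * \<theta> i \<le> t * \<theta> i" using that(3,4) unfolding c pi by auto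
      then show ?thesis using neg by simp
    qed
    then have "?p r \<in> K" using line_slice_convex[of x \<theta> s t r] line_slice_convex[of x \<theta> t s r] that(1,2) by blast
    then show False using that(5) \<theta>i by (simp add: crosses_def r_def)
  qed
  have "{t. ?p t \<in> A} = {} \<or> {t. ?p t \<in> A} = {t. ?p t \<in> K}"
  proof (rule ccontr)
    assume "\<not> ?thesis"
    then obtain s t where s: "?p s \<in> A" and t: "?p t \<in> K" "?p t \<notin> A" by (auto simp: A)
    then have "?p s \<in> K" "a < ?p s i" "?p s i \<le> b" "?p t i \<le> a \<or> b < ?p t i" by (auto simp: A)
    then show False using level[of t s a] level[of s t b] t(1) assms(2,3) by blast
  qed
  then show ?thesis unfolding line_length_eq by auto
qed

lemma exists_half_slab:
  assumes n: "n > 0"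
  shows "\<exists>A \<in> sets (vol n). A \<subseteq> K \<and> measure (vol n) A / measure (vol n) K = 1 / 2 \<and>
      measure (random_line n K)
        {(x, \<theta>) \<in> space (random_line n K).
           line_length n x \<theta> (line n x \<theta> \<inter> A) / line_length n x \<theta> (line n x \<theta> \<inter> K) \<in> {0, 1}}
        \<ge> 1 - 13872 / sqrt (real n)"
proof -
  \<comment> \<open>A coordinate of largest variance: it makes the variances of all coordinates at most \<open>var i\<close>.\<close>
  obtain i where i: "i < n" and V: "\<And>j. j < n \<Longrightarrow> var j \<le> var i"
  proof -
    have "Max (var ` {..<n}) \<in> var ` {..<n}" using n by (intro Max_in) auto
    then obtain i where "i < n" "var i = Max (var ` {..<n})" by auto
    then show ?thesis using that[of i] by auto
  qed
  interpret nu: real_distribution "marginal i" by (rule real_distribution_marginal[OF i])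
  have atomless: "nu.prob {t} = 0" for t using marginal_interval[OF i, of t t] by (simp add: measure_le_0_iff)
  obtain a b where ab: "nu.prob {a<..b} = 1 / 2"
    and cross: "crossing_prob i a + crossing_prob i b \<le> ennreal (3 * (4624 / sqrt (real n)))"
    using nu.halving_quantiles[OF atomless average_crossing_prob[OF i V]] n by auto
  define A where "A = {x \<in> K. x i \<in> {a<..b}}"
  have A[measurable]: "A \<in> sets (vol n)" unfolding A_def by (rule slab_measurable[OF i]) simp
  have "A \<subseteq> K" by (auto simp: A_def)
  have "measure (vol n) A / measure (vol n) K = nu.prob {a<..b}"
  proof -
    have "measure uni A = measure (vol n) (K \<inter> A) / measure (vol n) K"
      using vol_K by (intro measure_uniform_measure) auto
    moreover have "K \<inter> A = A" using \<open>A \<subseteq> K\<close> by auto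
    moreover have "nu.prob {a<..b} = measure uni A"
    proof -
      note [measurable] = coord[OF i]
      have "emeasure (marginal i) {a<..b} = emeasure (vol n) (K \<inter> A) / emeasure (vol n) K"
        using i \<open>K \<inter> A = A\<close> by (simp add: emeasure_marginal A_def)
      also have "\<dots> = emeasure uni A" by (rule emeasure_uniform_measure[symmetric]) auto
      finally show ?thesis by (simp add: measure_def)
    qed
    ultimately show ?thesis by simp
  qed
  then have half: "measure (vol n) A / measure (vol n) K = 1 / 2" using ab by simp

  define G where "G = {(x, \<theta>) \<in> space (random_line n K).
           line_length n x \<theta> (line n x \<theta> \<inter> A) / line_length n x \<theta> (line n x \<theta> \<inter> K) \<in> {0, 1}}"
  interpret N: prob_space "random_line n K" unfolding random_line_def by (rule pair.P.prob_space_axioms)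
  \<comment> \<open>The event must be measurable, since \<open>measure\<close> is \<open>0\<close> outside the sigma-algebra.\<close>
  have len: "(\<lambda>w. measure lborel {t. line_point n (fst w) (snd w) t \<in> S}) \<in> borel_measurable (random_line n K)"
    if [measurable]: "S \<in> sets (vol n)" for S
  proof -
    have eq: "measure lborel {t. line_point n (fst w) (snd w) t \<in> S} = enn2real (chord_length n S (fst w) (snd w))"
      if "w \<in> space (random_line n K)" for w
    proof -
      have [measurable]: "fst w \<in> space (vol n)" "snd w \<in> space (vol n)" using that by (auto simp: space_random_line)
      have "chord_length n S (fst w) (snd w) = (\<integral>\<^sup>+t. indicator {t. line_point n (fst w) (snd w) t \<in> S} t \<partial>lborel)"
        unfolding chord_length_def by (intro nn_integral_cong) (auto simp: indicator_def)
      also have "\<dots> = emeasure lborel {t. line_point n (fst w) (snd w) t \<in> S}"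
        by (rule nn_integral_indicator) measurable
      finally show ?thesis by (simp add: measure_def)
    qed
    have "(\<lambda>w. enn2real (chord_length n S (fst w) (snd w))) \<in> borel_measurable (random_line n K)" by measurable
    then show ?thesis by (subst measurable_cong[OF eq])
  qed
  have G_sets: "G \<in> N.events"
  proof -
    note [measurable] = len[OF A] len[OF K_sets]
    have "G = {w \<in> space (random_line n K). measure lborel {t. line_point n (fst w) (snd w) t \<in> A}
        / measure lborel {t. line_point n (fst w) (snd w) t \<in> K} \<in> {0, 1}}"
      unfolding G_def line_length_eq by auto
    also have "\<dots> \<in> N.events" by measurable
    finally show ?thesis .
  qed
  define Cr where "Cr c = {(x, \<theta>) \<in> space (random_line n K). crosses i x \<theta> c}" for c
  have Cr_sets: "Cr c \<in> N.events" for c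
  proof -
    have [measurable]: "Measurable.pred (random_line n K) (\<lambda>w. crosses i (fst w) (snd w) c)"
      by (rule measurable_crosses[OF i]) auto
    have "Cr c = {w \<in> space (random_line n K). crosses i (fst w) (snd w) c}" by (auto simp: Cr_def)
    also have "\<dots> \<in> N.events" by measurable
    finally show ?thesis .
  qed
  have "space (random_line n K) - G \<subseteq> Cr a \<union> Cr b"
    using uncrossed_ratio[OF i _ _ A_def] unfolding G_def Cr_def by blast
  then have "N.prob (space (random_line n K) - G) \<le> N.prob (Cr a \<union> Cr b)"
    using Cr_sets by (intro N.finite_measure_mono) auto
  also have "\<dots> \<le> N.prob (Cr a) + N.prob (Cr b)"
    using Cr_sets by (intro measure_Un_le)
  also have "\<dots> \<le> 3 * (4624 / sqrt (real n))"
  proof -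
    have "ennreal (N.prob (Cr a) + N.prob (Cr b)) = crossing_prob i a + crossing_prob i b"
      by (simp add: crossing_prob_def Cr_def N.emeasure_eq_measure ennreal_plus del: ennreal_plus_if)
    with cross have "ennreal (N.prob (Cr a) + N.prob (Cr b)) \<le> ennreal (3 * (4624 / sqrt (real n)))"
      by (simp only:)
    then show ?thesis by (subst (asm) ennreal_le_iff) simp_all
  qed
  finally have "1 - 13872 / sqrt (real n) \<le> N.prob G"
    using N.prob_compl[OF G_sets] by simp
  then show ?thesis using A \<open>A \<subseteq> K\<close> half unfolding G_def by blast
qed

end

theorem theorem1p2:
  shows "\<exists>C > (0::real). \<exists>\<alpha> > (0::real). \<forall>n \<ge> 2. \<forall>K. convex_body n K \<longrightarrow>
    (\<exists>A \<in> sets (vol n). A \<subseteq> K \<and> measure (vol n) A / measure (vol n) K = 1 / 2 \<and>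
      measure (random_line n K)
        {(x, \<theta>) \<in> space (random_line n K).
           line_length n x \<theta> (line n x \<theta> \<inter> A) / line_length n x \<theta> (line n x \<theta> \<inter> K) \<in> {0, 1}}
        \<ge> 1 - C * ln (real n) powr \<alpha> / sqrt (real n))"
proof (rule exI[of _ "13872 / ln 2"], rule conjI, simp, rule exI[of _ 1], intro conjI allI impI)
  fix n :: nat and K assume n: "2 \<le> n" and K: "convex_body n K"
  interpret uniform_in_body n K by standard (rule K)
  \<comment> \<open>The factor \<open>ln n / ln 2\<close> is at least 1 because \<open>n \<ge> 2\<close>.\<close>
  have "13872 \<le> 13872 / ln 2 * ln (real n) powr 1" using n by (simp add: field_simps)
  then have "1 - 13872 / ln 2 * ln (real n) powr 1 / sqrt (real n) \<le> 1 - 13872 / sqrt (real n)"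
    by (intro diff_left_mono divide_right_mono) auto
  then show "\<exists>A \<in> sets (vol n). A \<subseteq> K \<and> measure (vol n) A / measure (vol n) K = 1 / 2 \<and>
      measure (random_line n K)
        {(x, \<theta>) \<in> space (random_line n K).
           line_length n x \<theta> (line n x \<theta> \<inter> A) / line_length n x \<theta> (line n x \<theta> \<inter> K) \<in> {0, 1}}
        \<ge> 1 - 13872 / ln 2 * ln (real n) powr 1 / sqrt (real n)"
    using exists_half_slab n by (meson order_trans zero_less_numeral less_le_trans)
qed auto

end
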